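(* Let $X$ be a path connected space with basepoint $x_0$. Suppose $(\mathscr{U},U_0)\in\Lambda$ is such that $\mathscr{U}$ consists of path connected sets, and let $p_{\mathscr{U}}:X\to|N(\mathscr{U})|$ be a canonical map. Then the sequence of groups $$1\to \Pi^{Sp}(\mathscr{U},x_0)\xrightarrow{\ i_{\mathscr{U}}\ }\pi_1(X,x_0)\xrightarrow{\ p_{\mathscr{U}\ast}\ }\pi_1(|N(\mathscr{U})|,U_0)\to 1,$$ where $i_{\mathscr{U}}$ is the inclusion, is exact.
   Context: Paths are continuous maps from $[0,1]$, $\overline{\alpha}$ is the reverse path, and $[\alpha][\beta]=[\alpha\ast\beta]$ denotes concatenation of homotopy classes rel. endpoints. For an open cover $\mathscr{U}$ of $X$, the thick Spanier group $\Pi^{Sp}(\mathscr{U},x_0)$ is the subgroup of $\pi_1(X,x_0)$ generated by all elements $[\alpha][\gamma_1][\gamma_2][\overline{\alpha}]$ where $\alpha$ is a path with $\alpha(0)=x_0$, and $\gamma_1:[0,1]\to U_1$, $\gamma_2:[0,1]\to U_2$ are paths for some $U_1,U_2\in\mathscr{U}$ with $\gamma_1(0)=\gamma_2(1)=\alpha(1)$ and $\gamma_1(1)=\gamma_2(0)$. $\Lambda$ is the set of pairs $(\mathscr{U},U_0)$ where $\mathscr{U}$ is an open cover of $X$, $x_0\in U_0\in\mathscr{U}$, and there is a partition of unity $\{\phi_U\}_{U\in\mathscr{U}}$ subordinated to $\mathscr{U}$ with $\phi_{U_0}(x_0)=1$. The nerve $N(\mathscr{U})$ is the abstract simplicial complex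 with vertex set $\mathscr{U}$, in which $A_0,\dots,A_n$ span a simplex iff $\bigcap_i A_i\neq\emptyset$; $|N(\mathscr{U})|$ is its geometric realization, based at the vertex $U_0$. A (based) canonical map is a continuous map $p_{\mathscr{U}}:X\to|N(\mathscr{U})|$ with $p_{\mathscr{U}}(x_0)=U_0$ and $p_{\mathscr{U}}^{-1}(St(U,N(\mathscr{U})))\subseteq U$ for all $U\in\mathscr{U}$, where $St(U,N(\mathscr{U}))$ is the open star of the vertex $U$. $p_{\mathscr{U}\ast}$ is the induced homomorphism on fundamental groups. *)

theory Defs
  imports "HOL-Analysis.Analysis" "HOL-Algebra.Exact_Sequence"
begin

section \<open>The fundamental group\<close>

text \<open>Path concatenation and reversal are restated here because \<open>joinpaths\<close> and \<open>reversepath\<close>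
  require their codomain to be in a topological type class, whereas spaces below are values of type
  \<open>topology\<close>.  As in the library, only the values of a path on \<open>[0,1]\<close> matter.\<close>

definition path_join :: "(real \<Rightarrow> 'a) \<Rightarrow> (real \<Rightarrow> 'a) \<Rightarrow> real \<Rightarrow> 'a"
  where "path_join f g = (\<lambda>t. if t \<le> 1/2 then f (2 * t) else g (2 * t - 1))"

definition path_reverse :: "(real \<Rightarrow> 'a) \<Rightarrow> real \<Rightarrow> 'a"
  where "path_reverse f = (\<lambda>t. f (1 - t))"

definition path_homotopic :: "'a topology \<Rightarrow> (real \<Rightarrow> 'a) \<Rightarrow> (real \<Rightarrow> 'a) \<Rightarrow> bool"
  where "path_homotopic X f g \<longleftrightarrow>
    homotopic_with (\<lambda>r. r 0 = f 0 \<and> r 1 = f 1) (top_of_set {0..1}) X f g"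

definition path_class :: "'a topology \<Rightarrow> (real \<Rightarrow> 'a) \<Rightarrow> (real \<Rightarrow> 'a) set"
  where "path_class X f = {g. path_homotopic X f g}"

text \<open>Concatenation of homotopy classes; only meaningful when the endpoints match, in which case
  the union is over equal sets.\<close>

definition path_class_mult ::
    "'a topology \<Rightarrow> (real \<Rightarrow> 'a) set \<Rightarrow> (real \<Rightarrow> 'a) set \<Rightarrow> (real \<Rightarrow> 'a) set"
  where "path_class_mult X A B = (\<Union>f\<in>A. \<Union>g\<in>B. path_class X (path_join f g))"

definition fundamental_group :: "'a topology \<Rightarrow> 'a \<Rightarrow> (real \<Rightarrow> 'a) set monoid"
  where "fundamental_group X x0 =
    \<lparr>carrier = path_class X ` {f. pathin X f \<and> f 0 = x0 \<and> f 1 = x0},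
     monoid.mult = path_class_mult X,
     one = path_class X (\<lambda>_. x0)\<rparr>"

definition fundamental_group_induced ::
    "'b topology \<Rightarrow> ('a \<Rightarrow> 'b) \<Rightarrow> (real \<Rightarrow> 'a) set \<Rightarrow> (real \<Rightarrow> 'b) set"
  where "fundamental_group_induced Y p A = (\<Union>f\<in>A. path_class Y (p \<circ> f))"


section \<open>Thick Spanier groups\<close>

definition open_cover :: "'a topology \<Rightarrow> 'a set set \<Rightarrow> bool"
  where "open_cover X \<U> \<longleftrightarrow> (\<forall>U\<in>\<U>. openin X U) \<and> \<Union>\<U> = topspace X"

definition thick_spanier_generators ::
    "'a topology \<Rightarrow> 'a set set \<Rightarrow> 'a \<Rightarrow> (real \<Rightarrow> 'a) set set"
  where "thick_spanier_generators X \<U> x0 =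
    {path_class_mult X (path_class_mult X (path_class_mult X
        (path_class X \<alpha>) (path_class X \<gamma>1)) (path_class X \<gamma>2)) (path_class X (path_reverse \<alpha>))
     | \<alpha> \<gamma>1 \<gamma>2. pathin X \<alpha> \<and> \<alpha> 0 = x0 \<and>
        (\<exists>U1\<in>\<U>. \<exists>U2\<in>\<U>. pathin (subtopology X U1) \<gamma>1 \<and> pathin (subtopology X U2) \<gamma>2) \<and>
        \<gamma>1 0 = \<alpha> 1 \<and> \<gamma>2 1 = \<alpha> 1 \<and> \<gamma>1 1 = \<gamma>2 0}"

definition thick_spanier_group ::
    "'a topology \<Rightarrow> 'a set set \<Rightarrow> 'a \<Rightarrow> (real \<Rightarrow> 'a) set monoid"
  where "thick_spanier_group X \<U> x0 =
    subgroup_generated (fundamental_group X x0) (thick_spanier_generators X \<U> x0)"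


section \<open>Geometric realization of abstract simplicial complexes\<close>

text \<open>A simplicial complex is given by its set of simplices, which are finite nonempty sets of
  vertices.  Points of the realization are families of barycentric coordinates.\<close>

definition geometric_simplex :: "'v set \<Rightarrow> ('v \<Rightarrow> real) set"
  where "geometric_simplex \<sigma> = {b. (\<forall>v. 0 \<le> b v) \<and> (\<forall>v. v \<notin> \<sigma> \<longrightarrow> b v = 0) \<and> sum b \<sigma> = 1}"

text \<open>The realization carries the weak topology: a set is open iff its intersection with each closed
  simplex is open in that simplex.  The topology of a closed simplex is the Euclidean one, as all
  coordinates outside its finitely many vertices vanish.\<close>

definition geometric_realization :: "'v set set \<Rightarrow> ('v \<Rightarrow> real) topology"
  where "geometric_realization K = topology (\<lambda>W.
    W \<subseteq> (\<Union>\<sigma>\<in>K. geometric_simplex \<sigma>) \<and>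
    (\<forall>\<sigma>\<in>K. openin (subtopology (powertop_real UNIV) (geometric_simplex \<sigma>))
                (W \<inter> geometric_simplex \<sigma>)))"

lemma openin_geometric_realization:
  "openin (geometric_realization K) W \<longleftrightarrow>
    W \<subseteq> (\<Union>\<sigma>\<in>K. geometric_simplex \<sigma>) \<and>
    (\<forall>\<sigma>\<in>K. openin (subtopology (powertop_real UNIV) (geometric_simplex \<sigma>))
                (W \<inter> geometric_simplex \<sigma>))"
proof -
  let ?T = "\<lambda>\<sigma>. subtopology (powertop_real UNIV) (geometric_simplex \<sigma>)"
  have "istopology (\<lambda>W. W \<subseteq> (\<Union>\<sigma>\<in>K. geometric_simplex \<sigma>) \<and>
      (\<forall>\<sigma>\<in>K. openin (?T \<sigma>) (W \<inter> geometric_simplex \<sigma>)))"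
    unfolding istopology_def
  proof (intro conjI allI impI ballI; (elim conjE)?)
    fix S T \<sigma> assume "\<sigma> \<in> K" "\<forall>\<sigma>\<in>K. openin (?T \<sigma>) (S \<inter> geometric_simplex \<sigma>)"
      "\<forall>\<sigma>\<in>K. openin (?T \<sigma>) (T \<inter> geometric_simplex \<sigma>)"
    then have "openin (?T \<sigma>) ((S \<inter> geometric_simplex \<sigma>) \<inter> (T \<inter> geometric_simplex \<sigma>))"
      by (blast intro: openin_Int)
    moreover have "(S \<inter> geometric_simplex \<sigma>) \<inter> (T \<inter> geometric_simplex \<sigma>)
        = S \<inter> T \<inter> geometric_simplex \<sigma>"
      by auto
    ultimately show "openin (?T \<sigma>) (S \<inter> T \<inter> geometric_simplex \<sigma>)"
      by simp
  next
    fix \<K> \<sigma> assume "\<sigma> \<in> K" "\<forall>W\<in>\<K>. W \<subseteq> (\<Union>\<sigma>\<in>K. geometric_simplex \<sigma>) \<and>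
      (\<forall>\<sigma>\<in>K. openin (?T \<sigma>) (W \<inter> geometric_simplex \<sigma>))"
    then have "openin (?T \<sigma>) (\<Union>W\<in>\<K>. W \<inter> geometric_simplex \<sigma>)"
      by (blast intro: openin_Union)
    moreover have "(\<Union>W\<in>\<K>. W \<inter> geometric_simplex \<sigma>) = \<Union>\<K> \<inter> geometric_simplex \<sigma>"
      by auto
    ultimately show "openin (?T \<sigma>) (\<Union>\<K> \<inter> geometric_simplex \<sigma>)"
      by simp
  qed blast+
  then show ?thesis
    unfolding geometric_realization_def by (simp add: topology_inverse')
qed

lemma topspace_geometric_realization:
  "topspace (geometric_realization K) = (\<Union>\<sigma>\<in>K. geometric_simplex \<sigma>)"
proof
  show "topspace (geometric_realization K) \<subseteq> (\<Union>\<sigma>\<in>K. geometric_simplex \<sigma>)"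
    using openin_topspace openin_geometric_realization by blast
  have "(\<Union>\<tau>\<in>K. geometric_simplex \<tau>) \<inter> geometric_simplex \<sigma> = geometric_simplex \<sigma>" if "\<sigma> \<in> K" for \<sigma>
    using that by auto
  then have "openin (geometric_realization K) (\<Union>\<sigma>\<in>K. geometric_simplex \<sigma>)"
    unfolding openin_geometric_realization
    by (auto simp: openin_subtopology_refl)
  then show "(\<Union>\<sigma>\<in>K. geometric_simplex \<sigma>) \<subseteq> topspace (geometric_realization K)"
    by (rule openin_subset)
qed

definition realization_vertex :: "'v \<Rightarrow> 'v \<Rightarrow> real"
  where "realization_vertex v = (\<lambda>w. if w = v then 1 else 0)"

definition open_star :: "'v set set \<Rightarrow> 'v \<Rightarrow> ('v \<Rightarrow> real) set"
  where "open_star K v = {b \<in> topspace (geometric_realization K). b v > 0}"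


section \<open>Nerves, partitions of unity and canonical maps\<close>

definition nerve :: "'a set set \<Rightarrow> 'a set set set"
  where "nerve \<U> = {\<sigma>. finite \<sigma> \<and> \<sigma> \<noteq> {} \<and> \<sigma> \<subseteq> \<U> \<and> \<Inter>\<sigma> \<noteq> {}}"

text \<open>Neither local finiteness nor containment of the closed supports is required.  Requiring them
  would give the same set \<open>covers_Lambda\<close> below: if \<open>\<phi>\<close> is a partition of unity in the present sense,
  then normalizing \<open>max 0 (2 * \<phi> U - (SUP V. \<phi> V))\<close> yields one that has both properties, and
  \<open>\<phi> U0 x0 = 1\<close> is preserved.\<close>

definition partition_of_unity_subordinated ::
    "'a topology \<Rightarrow> 'a set set \<Rightarrow> ('a set \<Rightarrow> 'a \<Rightarrow> real) \<Rightarrow> bool"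
  where "partition_of_unity_subordinated X \<U> \<phi> \<longleftrightarrow>
    (\<forall>U\<in>\<U>. continuous_map X euclideanreal (\<phi> U) \<and> (\<forall>x\<in>topspace X. 0 \<le> \<phi> U x) \<and>
       {x \<in> topspace X. \<phi> U x \<noteq> 0} \<subseteq> U) \<and>
    (\<forall>x\<in>topspace X. ((\<lambda>U. \<phi> U x) has_sum 1) \<U>)"

definition covers_Lambda :: "'a topology \<Rightarrow> 'a \<Rightarrow> ('a set set \<times> 'a set) set"
  where "covers_Lambda X x0 =
    {(\<U>, U0). open_cover X \<U> \<and> x0 \<in> U0 \<and> U0 \<in> \<U> \<and>
      (\<exists>\<phi>. partition_of_unity_subordinated X \<U> \<phi> \<and> \<phi> U0 x0 = 1)}"

definition canonical_map ::
    "'a topology \<Rightarrow> 'a \<Rightarrow> 'a set set \<Rightarrow> 'a set \<Rightarrow> ('a \<Rightarrow> 'a set \<Rightarrow> real) \<Rightarrow> bool"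
  where "canonical_map X x0 \<U> U0 p \<longleftrightarrow>
    continuous_map X (geometric_realization (nerve \<U>)) p \<and>
    p x0 = realization_vertex U0 \<and>
    (\<forall>U\<in>\<U>. {x \<in> topspace X. p x \<in> open_star (nerve \<U>) U} \<subseteq> U)"


section \<open>Short exact sequences\<close>

text \<open>\<open>exact_seq\<close> and \<open>short_exact_sequence\<close> require all groups to have elements of the same type.\<close>

definition short_exact ::
    "('a, 'm) monoid_scheme \<Rightarrow> ('a \<Rightarrow> 'b) \<Rightarrow> ('b, 'n) monoid_scheme \<Rightarrow> ('b \<Rightarrow> 'c) \<Rightarrow>
     ('c, 'k) monoid_scheme \<Rightarrow> bool"
  where "short_exact A f B g C \<longleftrightarrow>
    group_hom A B f \<and> group_hom B C g \<and>
    inj_on f (carrier A) \<and> f ` carrier A = kernel B C g \<and> g ` carrier B = carrier C"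

lemma short_exact_iff_short_exact_sequence:
  "short_exact A f B g C \<longleftrightarrow> short_exact_sequence C B A g f"
  unfolding short_exact_def short_exact_sequence_iff
  by (auto simp: mon_def epi_def group_hom_def group_hom_axioms_def)

end

theory Submission
  imports Defs
begin

text \<open>A path in a closed star of \<open>|N(\<U>)|\<close> is determined up to homotopy by its endpoints, by coning it off
  to the vertex. A canonical map sends every path in \<open>U \<in> \<U>\<close> into the closed star of \<open>U\<close>. Hence the
  thick Spanier generators die. Conversely, a loop in \<open>|N(\<U>)|\<close> is cut into pieces lying in open stars,
  and each piece in the star of \<open>V\<close> is replaced by the image of a path in \<open>V\<close> between points chosen in
  the intersections of the supports; this gives surjectivity.

  For the kernel, modulo the thick Spanier group the class of a path inside a member of \<open>\<U>\<close> depends only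
  on its endpoints, and not on the member. Subdivide a null homotopy of \<open>p \<circ> f\<close> into a grid whose cells
  map into open stars, and choose for every grid point a point of \<open>X\<close> in the intersection of its support.
  The corners of a cell then lie in a common member of \<open>\<U>\<close>, so the edge path around a cell is trivial modulo
  the thick Spanier group, and \<open>f\<close> can be pushed across the grid row by row.\<close>


section \<open>Homotopy of paths\<close>

text \<open>The canonical condition runs in one direction only: every member with positive
  coordinate at \<open>p x\<close> contains \<open>x\<close>, but a member containing
  \<open>x\<close> may have coordinate 0 there. So \<open>p\<close> maps \<open>U\<close> into the
  closed star of \<open>U\<close> and possibly not into the open one, whereas subdivision needs an
  open cover and hence open stars. New simplices of the nerve arise by naming a common point of
  their vertices.

  In the weak topology coordinatewise continuity does not suffice. The homotopies written down by
  formulas are continuous because they stay in finitely many closed simplices, and compactness of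
  path images supplies this finiteness.

  The grid argument takes place in the quotient by the thick Spanier group, where a path stands for
  the loop obtained by adding chosen tails from \<open>x0\<close>. Crossing a cell is then an
  identity between group elements instead of a homotopy in \<open>X\<close>.\<close>

abbreviation unit_interval :: "real topology"
  where "unit_interval \<equiv> top_of_set {0..1}"

text \<open>Convention throughout: the first coordinate is the time of the homotopy, the second the
  parameter of the path. As in \<open>homotopic_with\<close>, the equations at times 0 and 1 concern
  all real parameters.\<close>

lemma path_homotopicI:
  assumes "continuous_map (prod_topology unit_interval unit_interval) X h"
    and "\<And>t. h (0, t) = f t" "\<And>t. h (1, t) = g t"
    and "\<And>s. s \<in> {0..1} \<Longrightarrow> h (s, 0) = f 0" "\<And>s. s \<in> {0..1} \<Longrightarrow> h (s, 1) = f 1"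
  shows "path_homotopic X f g"
  using assms unfolding path_homotopic_def homotopic_with_def by blast

lemma path_homotopicE:
  assumes "path_homotopic X f g"
  obtains h where "continuous_map (prod_topology unit_interval unit_interval) X h"
    and "\<And>t. h (0, t) = f t" "\<And>t. h (1, t) = g t"
    and "\<And>s. s \<in> {0..1} \<Longrightarrow> h (s, 0) = f 0" "\<And>s. s \<in> {0..1} \<Longrightarrow> h (s, 1) = f 1"
  using assms unfolding path_homotopic_def homotopic_with_def by auto

lemma path_homotopic_imp_pathin:
  assumes "path_homotopic X f g"
  shows "pathin X f" "pathin X g"
  using assms unfolding path_homotopic_def pathin_def
  by (blast dest: homotopic_with_imp_continuous_maps)+

lemma path_homotopic_endpoints:
  assumes "path_homotopic X f g"
  shows "g 0 = f 0" "g 1 = f 1"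
  using homotopic_with_imp_property[OF assms[unfolded path_homotopic_def]] by auto

lemma path_homotopic_refl: "pathin X f \<Longrightarrow> path_homotopic X f f"
  by (simp add: path_homotopic_def pathin_def)

lemma path_homotopic_sym: "path_homotopic X f g \<Longrightarrow> path_homotopic X g f"
  using path_homotopic_endpoints[of X f g] homotopic_with_symD
  unfolding path_homotopic_def by fastforce

lemma path_homotopic_trans [trans]:
  "path_homotopic X f g \<Longrightarrow> path_homotopic X g h \<Longrightarrow> path_homotopic X f h"
  using path_homotopic_endpoints[of X f g] homotopic_with_trans
  unfolding path_homotopic_def by fastforce

lemma path_homotopic_eq_on:
  assumes "pathin X f" and "\<And>t. t \<in> {0..1} \<Longrightarrow> f t = g t"
  shows "path_homotopic X f g"
  unfolding path_homotopic_def
  by (rule homotopic_with_equal) (use assms in \<open>auto simp: pathin_def\<close>)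

lemma path_homotopic_compose:
  assumes "path_homotopic X f g" and "continuous_map X Y p"
  shows "path_homotopic Y (p \<circ> f) (p \<circ> g)"
  using assms unfolding path_homotopic_def
  by (auto intro: homotopic_with_compose_continuous_map_left)

text \<open>Both homotopies keep the common endpoint fixed, so they can be pasted along
  \<open>snd z = 1/2\<close> at every time.\<close>

lemma path_homotopic_join:
  assumes "path_homotopic X f f'" "path_homotopic X g g'" "f 1 = g 0"
  shows "path_homotopic X (path_join f g) (path_join f' g')"
proof -
  let ?I2 = "prod_topology unit_interval unit_interval"
  obtain h where h: "continuous_map ?I2 X h" "\<And>t. h (0, t) = f t" "\<And>t. h (1, t) = f' t"
    "\<And>s. s \<in> {0..1} \<Longrightarrow> h (s, 0) = f 0" "\<And>s. s \<in> {0..1} \<Longrightarrow> h (s, 1) = f 1"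
    using path_homotopicE[OF assms(1)] by metis
  obtain k where k: "continuous_map ?I2 X k" "\<And>t. k (0, t) = g t" "\<And>t. k (1, t) = g' t"
    "\<And>s. s \<in> {0..1} \<Longrightarrow> k (s, 0) = g 0" "\<And>s. s \<in> {0..1} \<Longrightarrow> k (s, 1) = g 1"
    using path_homotopicE[OF assms(2)] by metis
  let ?H = "\<lambda>z. if snd z \<le> 1/2 then h (fst z, 2 * snd z) else k (fst z, 2 * snd z - 1)"
  have "continuous_map ?I2 X ?H"
  proof (rule continuous_map_cases_le)
    show "continuous_map ?I2 euclideanreal snd"
      by (metis continuous_map_in_subtopology continuous_map_snd)
    have "continuous_map (subtopology ?I2 {z \<in> topspace ?I2. snd z \<le> 1/2}) ?I2
        (\<lambda>z. (fst z, 2 * snd z))"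
      by (auto simp flip: subtopology_Times
          simp: subtopology_subtopology continuous_map_in_subtopology intro!: continuous_intros)
    then show "continuous_map (subtopology ?I2 {z \<in> topspace ?I2. snd z \<le> 1/2}) X
        (\<lambda>z. h (fst z, 2 * snd z))"
      using continuous_map_compose[of _ ?I2 "\<lambda>z. (fst z, 2 * snd z)" X h] h(1)
      unfolding o_def by blast
    have "continuous_map (subtopology ?I2 {z \<in> topspace ?I2. 1/2 \<le> snd z}) ?I2
        (\<lambda>z. (fst z, 2 * snd z - 1))"
      by (auto simp flip: subtopology_Times
          simp: subtopology_subtopology continuous_map_in_subtopology intro!: continuous_intros)
    then show "continuous_map (subtopology ?I2 {z \<in> topspace ?I2. 1/2 \<le> snd z}) X
        (\<lambda>z. k (fst z, 2 * snd z - 1))"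
      using continuous_map_compose[of _ ?I2 "\<lambda>z. (fst z, 2 * snd z - 1)" X k] k(1)
      unfolding o_def by blast
    show "h (fst z, 2 * snd z) = k (fst z, 2 * snd z - 1)"
      if "z \<in> topspace ?I2" "snd z = 1/2" for z
    proof -
      have "2 * snd z = 1"
        using that(2) by simp
      then show ?thesis
        using that(1) h(5)[of "fst z"] k(4)[of "fst z"] assms(3) by (auto simp: mem_Times_iff)
    qed
  qed simp
  then show ?thesis
    by (rule path_homotopicI) (use h k in \<open>auto simp: path_join_def\<close>)
qed

text \<open>No second pasting argument is needed: constant homotopies are joined, and the ends of a
  homotopy are continuous.\<close>

lemma pathin_join:
  "pathin X f \<Longrightarrow> pathin X g \<Longrightarrow> f 1 = g 0 \<Longrightarrow> pathin X (path_join f g)"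
  by (meson path_homotopic_imp_pathin(1) path_homotopic_join path_homotopic_refl)

lemma path_join_simps [simp]:
  "path_join f g 0 = f 0" "path_join f g 1 = g 1"
  by (simp_all add: path_join_def)

lemma path_join_in:
  assumes "\<And>t. t \<in> {0..1} \<Longrightarrow> f t \<in> S" "\<And>t. t \<in> {0..1} \<Longrightarrow> g t \<in> S" "t \<in> {0..1}"
  shows "path_join f g t \<in> S"
  using assms by (simp add: path_join_def)

lemma path_reverse_simps [simp]:
  "path_reverse f 0 = f 1" "path_reverse f 1 = f 0"
  by (simp_all add: path_reverse_def)

lemma path_join_compose: "p \<circ> path_join f g = path_join (p \<circ> f) (p \<circ> g)"
  by (auto simp: path_join_def)

section \<open>Reparametrization and the groupoid laws\<close>

lemma pathin_reparametrize:
  assumes "pathin X f" "pathin unit_interval \<phi>"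
  shows "pathin X (f \<circ> \<phi>)"
  using assms unfolding pathin_def by (rule continuous_map_compose[rotated])

text \<open>The interval is convex, so the straight-line homotopy from \<open>\<phi>\<close> to
  \<open>\<psi>\<close> stays inside it and can be followed by \<open>f\<close>. Reparametrizations
  may run backwards, which is why this one fact also yields inverses.\<close>

lemma path_homotopic_reparametrize:
  assumes f: "pathin X f" and \<phi>: "pathin unit_interval \<phi>" and \<psi>: "pathin unit_interval \<psi>"
    and "\<phi> 0 = \<psi> 0" "\<phi> 1 = \<psi> 1"
  shows "path_homotopic X (f \<circ> \<phi>) (f \<circ> \<psi>)"
proof -
  have cont: "continuous_on {0..1} \<phi>" "continuous_on {0..1} \<psi>"
    and range: "\<And>t. t \<in> {0..1} \<Longrightarrow> \<phi> t \<in> {0..1}" "\<And>t. t \<in> {0..1} \<Longrightarrow> \<psi> t \<in> {0..1}"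
    using \<phi> \<psi> by (auto simp: pathin_def)
  have "path_homotopic unit_interval \<phi> \<psi>"
  proof (rule path_homotopicI)
    let ?h = "\<lambda>z. (1 - fst z) * \<phi> (snd z) + fst z * \<psi> (snd z)"
    have "?h (s, t) \<in> {0..1}" if "s \<in> {0..1}" "t \<in> {0..1}" for s t
      using convexD_alt[of "{0..1::real}" "\<phi> t" "\<psi> t" s] range[OF that(2)] that by simp
    moreover have "continuous_on ({0..1} \<times> {0..1}) ?h"
      by (intro continuous_intros continuous_on_compose2[OF cont(1)] continuous_on_compose2[OF cont(2)])
        auto
    ultimately show "continuous_map (prod_topology unit_interval unit_interval) unit_interval ?h"
      by (auto simp flip: subtopology_Times simp: Pi_iff split_paired_all)
  qed (use assms in \<open>auto simp: algebra_simps\<close>)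
  then show ?thesis
    using f by (simp add: pathin_def path_homotopic_compose)
qed

lemma pathin_linepath:
  assumes "a \<in> {0..1}" "b \<in> {0..1}"
  shows "pathin unit_interval (linepath a b)"
  using assms convexD_alt[of "{0..1::real}" a b]
  by (auto simp: pathin_def linepath_def intro!: continuous_intros)

lemma linepath_endpoints [simp]: "linepath a b 0 = a" "linepath a b 1 = b"
  by (simp_all add: linepath_def)

lemmas pathin_intros = pathin_join pathin_linepath pathin_reparametrize

lemma pathin_reverse: "pathin X f \<Longrightarrow> pathin X (path_reverse f)"
  using pathin_reparametrize[OF _ pathin_linepath[of 1 0], of X f]
  by (simp add: o_def path_reverse_def linepath_def)

text \<open>The parameters may come in any order. Coinciding neighbours give the unit laws,
  \<open>a = c\<close> gives the inverse laws, and increasing parameters glue the pieces of a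
  subdivided path.\<close>

lemma path_homotopic_join_linepath:
  assumes "pathin X f" "a \<in> {0..1}" "b \<in> {0..1}" "c \<in> {0..1}"
  shows "path_homotopic X (path_join (f \<circ> linepath a b) (f \<circ> linepath b c)) (f \<circ> linepath a c)"
  unfolding path_join_compose[symmetric]
  by (rule path_homotopic_reparametrize) (use assms in \<open>auto intro!: pathin_intros\<close>)

lemma comp_linepath_0_1: "f \<circ> linepath 0 1 = (f :: real \<Rightarrow> 'a)"
  by (auto simp: linepath_def)

lemma comp_linepath_1_0: "f \<circ> linepath 1 0 = path_reverse f"
  by (auto simp: linepath_def path_reverse_def)

lemma comp_linepath_same: "f \<circ> linepath a a = (\<lambda>_. f a)"
  by (auto simp: linepath_def simp flip: distrib_right)

lemma path_homotopic_const_join: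
  assumes "pathin X f" "f 0 = a" shows "path_homotopic X (path_join (\<lambda>_. a) f) f"
  using path_homotopic_join_linepath[OF assms(1), of 0 0 1] assms(2)
  by (simp add: comp_linepath_0_1 comp_linepath_same)

lemma path_homotopic_join_const:
  assumes "pathin X f" "f 1 = b" shows "path_homotopic X (path_join f (\<lambda>_. b)) f"
  using path_homotopic_join_linepath[OF assms(1), of 0 1 1] assms(2)
  by (simp add: comp_linepath_0_1 comp_linepath_same)

lemma path_homotopic_join_reverse:
  assumes "pathin X f" "f 0 = a" shows "path_homotopic X (path_join f (path_reverse f)) (\<lambda>_. a)"
  using path_homotopic_join_linepath[OF assms(1), of 0 1 0] assms(2)
  by (simp add: comp_linepath_0_1 comp_linepath_1_0 comp_linepath_same)

lemma path_homotopic_reverse_join: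
  assumes "pathin X f" "f 1 = b" shows "path_homotopic X (path_join (path_reverse f) f) (\<lambda>_. b)"
  using path_homotopic_join_linepath[OF assms(1), of 1 0 1] assms(2)
  by (simp add: comp_linepath_0_1 comp_linepath_1_0 comp_linepath_same)

lemma path_homotopic_assoc:
  assumes "pathin X f" "pathin X g" "pathin X h" "f 1 = g 0" "g 1 = h 0"
  shows "path_homotopic X (path_join (path_join f g) h) (path_join f (path_join g h))"
proof -
  let ?F = "path_join f (path_join g h)"
  \<comment> \<open>The left bracketing changes path at 1/4 and 1/2, the right one at 1/2 and 3/4;
    \<open>?\<phi>\<close> is the piecewise linear map carrying the first pair to the
    second.\<close>
  let ?\<phi> = "path_join (path_join (linepath 0 (1/2)) (linepath (1/2) (3/4))) (linepath (3/4) (1::real))"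
  have F: "pathin X ?F"
    using assms by (simp add: pathin_join)
  have \<phi>: "pathin unit_interval ?\<phi>"
    by (intro pathin_intros) auto
  have "(?F \<circ> ?\<phi>) t = path_join (path_join f g) h t" if "t \<in> {0..1}" for t
  proof -
    consider "t \<le> 1/4" | "1/4 < t" "t < 1/2" | "t = 1/2" | "1/2 < t" by linarith
    then show ?thesis
    proof cases
      case 2
      then have "linepath (1/2) (3/4) (4 * t - 1) = (t + 1/4)"
        by (simp add: linepath_def field_simps)
      with 2 show ?thesis
        by (simp add: path_join_def)
    next
      case 3
      show ?thesis
        unfolding 3 using assms(4) by (simp add: path_join_def linepath_def)
    qed (use that in \<open>simp_all add: path_join_def linepath_def field_simps\<close>)
  qed
  then have "path_homotopic X (?F \<circ> ?\<phi>) (path_join (path_join f g) h)"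
    by (intro path_homotopic_eq_on pathin_reparametrize F \<phi>)
  moreover have "path_homotopic X (?F \<circ> ?\<phi>) (?F \<circ> linepath 0 1)"
    by (rule path_homotopic_reparametrize[OF F \<phi> pathin_linepath]) auto
  ultimately show ?thesis
    unfolding comp_linepath_0_1 by (meson path_homotopic_sym path_homotopic_trans)
qed

lemma path_homotopic_join_left:
  "path_homotopic X f f' \<Longrightarrow> pathin X g \<Longrightarrow> f 1 = g 0 \<Longrightarrow> path_homotopic X (path_join f g) (path_join f' g)"
  by (simp add: path_homotopic_join path_homotopic_refl)

lemma path_homotopic_join_right:
  "pathin X f \<Longrightarrow> path_homotopic X g g' \<Longrightarrow> f 1 = g 0 \<Longrightarrow> path_homotopic X (path_join f g) (path_join f g')"
  by (simp add: path_homotopic_join path_homotopic_refl)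

text \<open>This makes loops built with tails multiply correctly: the return path of one loop
  cancels the tail of the next.\<close>

lemma path_homotopic_cancel_reverse:
  assumes "pathin X f" "pathin X g" "pathin X h" "f 1 = g 1" "h 0 = g 1"
  shows "path_homotopic X (path_join (path_join f (path_reverse g)) (path_join g h)) (path_join f h)"
proof -
  note [simp] = pathin_join pathin_reverse
  have "path_homotopic X (path_join (path_join f (path_reverse g)) (path_join g h))
      (path_join f (path_join (path_reverse g) (path_join g h)))"
    using assms by (intro path_homotopic_assoc) auto
  also have "path_homotopic X \<dots> (path_join f h)"
  proof (rule path_homotopic_join_right)
    have "path_homotopic X (path_join (path_reverse g) (path_join g h))
        (path_join (path_join (path_reverse g) g) h)"
      using assms by (intro path_homotopic_sym[OF path_homotopic_assoc]) auto
    also have "path_homotopic X \<dots> (path_join (\<lambda>_. h 0) h)"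
      using assms by (intro path_homotopic_join_left path_homotopic_reverse_join) auto
    also have "path_homotopic X \<dots> h"
      using assms by (intro path_homotopic_const_join) auto
    finally show "path_homotopic X (path_join (path_reverse g) (path_join g h)) h" .
  qed (use assms in auto)
  finally show ?thesis .
qed

text \<open>The two sides agree as functions; only at 1/2, where they take the values
  \<open>f 1\<close> and \<open>g 0\<close>, is the matching of endpoints used.\<close>

lemma path_homotopic_reverse_of_join:
  assumes "pathin X f" "pathin X g" "f 1 = g 0"
  shows "path_homotopic X (path_reverse (path_join f g)) (path_join (path_reverse g) (path_reverse f))"
proof (rule path_homotopic_eq_on)
  fix t :: real
  consider "t < 1/2" | "t = 1/2" | "1/2 < t" by linarith
  then show "path_reverse (path_join f g) t = path_join (path_reverse g) (path_reverse f) t"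
    using assms(3) by cases (auto simp: path_reverse_def path_join_def algebra_simps)
qed (use assms in \<open>simp add: pathin_reverse pathin_join\<close>)


section \<open>The fundamental group\<close>

lemma path_class_eq:
  assumes "path_homotopic X f g" shows "path_class X f = path_class X g"
  using assms unfolding path_class_def
  by (auto intro: path_homotopic_trans path_homotopic_sym)

text \<open>The class of a discontinuous map is empty, so equality of classes alone would not relate
  \<open>f\<close> to \<open>g\<close>.\<close>

lemma path_class_eqD:
  assumes "path_class X f = path_class X g" "pathin X g"
  shows "path_homotopic X f g"
  using assms path_homotopic_refl unfolding path_class_def by blast

lemma path_class_mult:
  assumes "pathin X f" "pathin X g" "f 1 = g 0"
  shows "path_class_mult X (path_class X f) (path_class X g) = path_class X (path_join f g)"
proof -
  have "path_class X (path_join f' g') = path_class X (path_join f g)"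
    if "f' \<in> path_class X f" "g' \<in> path_class X g" for f' g'
    using that assms path_class_eq path_homotopic_join unfolding path_class_def
    by (metis mem_Collect_eq)
  moreover have "f \<in> path_class X f" "g \<in> path_class X g"
    using assms by (auto simp: path_class_def path_homotopic_refl)
  ultimately show ?thesis
    unfolding path_class_mult_def by blast
qed

lemma path_class_mult_assoc:
  assumes "pathin X f" "pathin X g" "pathin X h" "f 1 = g 0" "g 1 = h 0"
  shows "path_class_mult X (path_class_mult X (path_class X f) (path_class X g)) (path_class X h)
    = path_class_mult X (path_class X f) (path_class_mult X (path_class X g) (path_class X h))"
  using assms by (simp add: path_class_mult pathin_join path_class_eq[OF path_homotopic_assoc])

lemma fundamental_group_simps:
  "carrier (fundamental_group X x0) = path_class X ` {f. pathin X f \<and> f 0 = x0 \<and> f 1 = x0}"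
  "mult (fundamental_group X x0) = path_class_mult X"
  "one (fundamental_group X x0) = path_class X (\<lambda>_. x0)"
  by (simp_all add: fundamental_group_def)

lemma path_class_in_carrier:
  "pathin X f \<Longrightarrow> f 0 = x0 \<Longrightarrow> f 1 = x0 \<Longrightarrow> path_class X f \<in> carrier (fundamental_group X x0)"
  by (simp add: fundamental_group_simps)

lemma group_fundamental_group:
  assumes "x0 \<in> topspace X"
  shows "group (fundamental_group X x0)"
proof (rule groupI)
  let ?G = "fundamental_group X x0"
  show "\<one>\<^bsub>?G\<^esub> \<in> carrier ?G"
    using assms by (auto simp: fundamental_group_simps)
  fix x assume "x \<in> carrier ?G"
  then obtain f where f: "x = path_class X f" "pathin X f" "f 0 = x0" "f 1 = x0"
    by (auto simp: fundamental_group_simps)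
  show "\<one>\<^bsub>?G\<^esub> \<otimes>\<^bsub>?G\<^esub> x = x"
    using f assms
    by (simp add: fundamental_group_simps path_class_mult path_class_eq[OF path_homotopic_const_join])
  have "path_class X (path_reverse f) \<otimes>\<^bsub>?G\<^esub> x = \<one>\<^bsub>?G\<^esub>"
    using f path_class_eq[OF path_homotopic_reverse_join[of X f x0]]
    by (simp add: fundamental_group_simps path_class_mult pathin_reverse)
  then show "\<exists>y\<in>carrier ?G. y \<otimes>\<^bsub>?G\<^esub> x = \<one>\<^bsub>?G\<^esub>"
    using f by (metis path_class_in_carrier pathin_reverse path_reverse_simps)
  fix y assume "y \<in> carrier ?G"
  then obtain g where g: "y = path_class X g" "pathin X g" "g 0 = x0" "g 1 = x0"
    by (auto simp: fundamental_group_simps)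
  show "x \<otimes>\<^bsub>?G\<^esub> y \<in> carrier ?G"
    using f g by (simp add: fundamental_group_simps path_class_mult pathin_join)
  fix z assume "z \<in> carrier ?G"
  then obtain h where "z = path_class X h" "pathin X h" "h 0 = x0" "h 1 = x0"
    by (auto simp: fundamental_group_simps)
  then show "x \<otimes>\<^bsub>?G\<^esub> y \<otimes>\<^bsub>?G\<^esub> z = x \<otimes>\<^bsub>?G\<^esub> (y \<otimes>\<^bsub>?G\<^esub> z)"
    using f g path_class_mult_assoc[of X f g h] by (simp add: fundamental_group_simps)
qed

lemma inv_fundamental_group:
  assumes "x0 \<in> topspace X" "pathin X f" "f 0 = x0" "f 1 = x0"
  shows "inv\<^bsub>fundamental_group X x0\<^esub> (path_class X f) = path_class X (path_reverse f)"
proof -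
  interpret group "fundamental_group X x0"
    by (rule group_fundamental_group[OF assms(1)])
  have "path_class X (path_reverse f) \<otimes>\<^bsub>fundamental_group X x0\<^esub> path_class X f
      = \<one>\<^bsub>fundamental_group X x0\<^esub>"
    using assms path_class_eq[OF path_homotopic_reverse_join[of X f x0]]
    by (simp add: fundamental_group_simps path_class_mult pathin_reverse)
  then show ?thesis
    using assms by (intro inv_equality) (auto intro: path_class_in_carrier pathin_reverse)
qed

lemma fundamental_group_induced_path_class:
  assumes "continuous_map X Y p" "pathin X f"
  shows "fundamental_group_induced Y p (path_class X f) = path_class Y (p \<circ> f)"
proof -
  have "path_class Y (p \<circ> g) = path_class Y (p \<circ> f)" if "g \<in> path_class X f" for g
    using that assms path_class_eq path_homotopic_compose unfolding path_class_def
    by (metis mem_Collect_eq)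
  moreover have "f \<in> path_class X f"
    using assms by (simp add: path_class_def path_homotopic_refl)
  ultimately show ?thesis
    unfolding fundamental_group_induced_def by blast
qed

lemma group_hom_fundamental_group_induced:
  assumes "continuous_map X Y p" "x0 \<in> topspace X"
  shows "group_hom (fundamental_group X x0) (fundamental_group Y (p x0)) (fundamental_group_induced Y p)"
proof -
  have "p x0 \<in> topspace Y"
    using assms by (auto simp: continuous_map_def Pi_iff)
  moreover have "fundamental_group_induced Y p \<in> hom (fundamental_group X x0) (fundamental_group Y (p x0))"
  proof (rule homI)
    fix a assume "a \<in> carrier (fundamental_group X x0)"
    then obtain f where f: "a = path_class X f" "pathin X f" "f 0 = x0" "f 1 = x0"
      by (auto simp: fundamental_group_simps)
    then have pf: "pathin Y (p \<circ> f)"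
      using assms pathin_compose by blast
    then show "fundamental_group_induced Y p a \<in> carrier (fundamental_group Y (p x0))"
      using f assms by (simp add: fundamental_group_induced_path_class path_class_in_carrier)
    fix b assume "b \<in> carrier (fundamental_group X x0)"
    then obtain g where g: "b = path_class X g" "pathin X g" "g 0 = x0" "g 1 = x0"
      by (auto simp: fundamental_group_simps)
    then have pg: "pathin Y (p \<circ> g)"
      using assms pathin_compose by blast
    have "path_class_mult X a b = path_class X (path_join f g)" "pathin X (path_join f g)"
      using f g by (simp_all add: path_class_mult pathin_join)
    then show "fundamental_group_induced Y p (a \<otimes>\<^bsub>fundamental_group X x0\<^esub> b)
        = fundamental_group_induced Y p a \<otimes>\<^bsub>fundamental_group Y (p x0)\<^esub> fundamental_group_induced Y p b"
      using assms f g pf pg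
      by (simp add: fundamental_group_simps fundamental_group_induced_path_class path_class_mult
          path_join_compose)
  qed
  ultimately show ?thesis
    using assms by (simp add: group_hom_def group_hom_axioms_def group_fundamental_group)
qed


section \<open>Geometric realizations\<close>

text \<open>For a point of the realization this is the vertex set of its carrier, the smallest
  simplex containing it.\<close>

definition support :: "('v \<Rightarrow> real) \<Rightarrow> 'v set"
  where "support b = {v. b v \<noteq> 0}"

lemma support_realization_vertex [simp]: "support (realization_vertex v) = {v}"
  by (auto simp: support_def realization_vertex_def)

lemma realization_vertex_in_simplex:
  "finite \<sigma> \<Longrightarrow> v \<in> \<sigma> \<Longrightarrow> realization_vertex v \<in> geometric_simplex \<sigma>"
  by (auto simp: geometric_simplex_def realization_vertex_def)

lemma geometric_simplex_convex:
  assumes "b \<in> geometric_simplex \<sigma>" "c \<in> geometric_simplex \<sigma>" "0 \<le> s" "s \<le> 1"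
  shows "(\<lambda>v. (1 - s) * b v + s * c v) \<in> geometric_simplex \<sigma>"
  using assms by (auto simp: geometric_simplex_def sum.distrib simp flip: sum_distrib_left)

lemma geometric_simplex_mono:
  assumes "finite \<tau>" "\<sigma> \<subseteq> \<tau>" shows "geometric_simplex \<sigma> \<subseteq> geometric_simplex \<tau>"
proof
  fix b assume b: "b \<in> geometric_simplex \<sigma>"
  then have "sum b \<sigma> = sum b \<tau>"
    using assms by (intro sum.mono_neutral_left) (auto simp: geometric_simplex_def)
  then show "b \<in> geometric_simplex \<tau>"
    using b assms by (auto simp: geometric_simplex_def)
qed

lemma support_of_simplex:
  assumes "b \<in> geometric_simplex \<sigma>" "finite \<sigma>"
  shows "support b \<subseteq> \<sigma>" "support b \<noteq> {}" "b \<in> geometric_simplex (support b)"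
proof -
  show sub: "support b \<subseteq> \<sigma>"
    using assms by (auto simp: support_def geometric_simplex_def)
  have "sum b (support b) = sum b \<sigma>"
    using assms sub by (intro sum.mono_neutral_left) (auto simp: support_def)
  then have "sum b (support b) = 1"
    using assms by (simp add: geometric_simplex_def)
  then show "support b \<noteq> {}"
    by auto
  show "b \<in> geometric_simplex (support b)"
    using assms \<open>sum b (support b) = 1\<close> by (auto simp: geometric_simplex_def support_def)
qed

text \<open>Relative and absolute closedness thus agree for subsets of a simplex, so the weak
  topology can be tested with plain \<open>closed\<close>.\<close>

lemma closed_geometric_simplex: "closed (geometric_simplex \<sigma>)"
proof -
  have "geometric_simplex \<sigma> =
      (\<Inter>v. {b. 0 \<le> b v}) \<inter> (\<Inter>v\<in>-\<sigma>. {b. b v = 0}) \<inter> {b. (\<Sum>v\<in>\<sigma>. b v) = 1}"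
    by (auto simp: geometric_simplex_def)
  then show ?thesis
    by (auto intro!: closed_Int closed_INT closed_Collect_le closed_Collect_eq continuous_intros)
qed

text \<open>The weak topology is finer than the one induced by the product, so the inclusion into
  the function space is continuous.\<close>

lemma continuous_map_realization_coordinate:
  "continuous_map (geometric_realization K) euclideanreal (\<lambda>b. b v)"
proof -
  have "continuous_map (geometric_realization K) euclidean (\<lambda>b. b)"
    unfolding continuous_map_def
  proof (intro conjI allI impI)
    fix U :: "('a \<Rightarrow> real) set" assume U: "openin euclidean U"
    have "{b \<in> topspace (geometric_realization K). b \<in> U} \<inter> geometric_simplex \<sigma>
        = geometric_simplex \<sigma> \<inter> U" if "\<sigma> \<in> K" for \<sigma>
      using that by (auto simp: topspace_geometric_realization)
    then show "openin (geometric_realization K) {b \<in> topspace (geometric_realization K). b \<in> U}"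
      using U by (auto simp: openin_geometric_realization euclidean_product_topology
          topspace_geometric_realization openin_open_Int)
  qed simp
  moreover have "continuous_map euclidean euclideanreal (\<lambda>b. b v)"
    by (simp add: continuous_on_product_coordinates)
  ultimately show ?thesis
    by (rule continuous_map_compose[where g = "\<lambda>b. b v", unfolded o_def])
qed

definition segment :: "('v \<Rightarrow> real) \<Rightarrow> ('v \<Rightarrow> real) \<Rightarrow> real \<Rightarrow> 'v \<Rightarrow> real"
  where "segment b c = (\<lambda>t v. (1 - t) * b v + t * c v)"

lemma segment_simps [simp]:
  "segment b c 0 = b" "segment b c 1 = c" "segment b b = (\<lambda>_. b)"
  by (auto simp: segment_def algebra_simps)

section \<open>Finite subcomplexes and compact sets in the weak topology\<close>

locale simplicial_complex =
  fixes K :: "'v set set"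
  assumes finite_simplex: "\<sigma> \<in> K \<Longrightarrow> finite \<sigma>"
    and face: "\<sigma> \<in> K \<Longrightarrow> \<tau> \<subseteq> \<sigma> \<Longrightarrow> \<tau> \<noteq> {} \<Longrightarrow> \<tau> \<in> K"
begin

abbreviation "realization \<equiv> geometric_realization K"

lemma in_realizationD:
  assumes "b \<in> topspace realization"
  shows "support b \<in> K" "b \<in> geometric_simplex (support b)"
proof -
  obtain \<sigma> where "\<sigma> \<in> K" "b \<in> geometric_simplex \<sigma>"
    using assms by (auto simp: topspace_geometric_realization)
  then show "support b \<in> K" "b \<in> geometric_simplex (support b)"
    using support_of_simplex[of b \<sigma>] finite_simplex face by auto
qed

lemma in_realization:
  assumes "b \<in> geometric_simplex \<sigma>" "\<sigma> \<in> K" shows "b \<in> topspace realization"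
  using assms by (auto simp: topspace_geometric_realization)

lemma closedin_realization:
  "closedin realization C \<longleftrightarrow>
    C \<subseteq> topspace realization \<and> (\<forall>\<sigma>\<in>K. closed (C \<inter> geometric_simplex \<sigma>))"
proof -
  have "openin (top_of_set (geometric_simplex \<sigma>)) ((topspace realization - C) \<inter> geometric_simplex \<sigma>)
      \<longleftrightarrow> closed (C \<inter> geometric_simplex \<sigma>)" if "\<sigma> \<in> K" for \<sigma>
  proof -
    have "(topspace realization - C) \<inter> geometric_simplex \<sigma> = geometric_simplex \<sigma> - C \<inter> geometric_simplex \<sigma>"
      using that by (auto simp: topspace_geometric_realization)
    moreover have "closed (C \<inter> geometric_simplex \<sigma>)
        \<longleftrightarrow> closedin (top_of_set (geometric_simplex \<sigma>)) (C \<inter> geometric_simplex \<sigma>)"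
      by (simp add: closedin_closed_eq closed_geometric_simplex)
    ultimately show ?thesis
      by (simp add: closedin_def)
  qed
  then show ?thesis
    by (auto simp: closedin_def openin_geometric_realization euclidean_product_topology
        topspace_geometric_realization)
qed

text \<open>On finitely many closed simplices the weak topology is the product topology: the
  preimage of a closed \<open>C\<close> is that of the finite union of the pieces
  \<open>C \<inter> geometric_simplex \<sigma>\<close>, each closed in the product.\<close>

lemma continuous_map_into_realization:
  assumes "finite \<Sigma>" "\<Sigma> \<subseteq> K"
    and "\<And>y. y \<in> topspace Y \<Longrightarrow> \<exists>\<sigma>\<in>\<Sigma>. f y \<in> geometric_simplex \<sigma>"
    and "\<And>v. continuous_map Y euclideanreal (\<lambda>y. f y v)"
  shows "continuous_map Y realization f"
  unfolding continuous_map_closedin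
proof (intro conjI ballI allI impI)
  have cont: "continuous_map Y euclidean f"
    using assms(4) continuous_map_coordinatewise_then_product[of UNIV Y "\<lambda>_. euclideanreal" f]
    by (simp add: euclidean_product_topology)
  fix C assume C: "closedin realization C"
  have "closed (\<Union>\<sigma>\<in>\<Sigma>. C \<inter> geometric_simplex \<sigma>)"
    using assms(1,2) C[unfolded closedin_realization] by (intro closed_UN) auto
  then have "closedin Y {y \<in> topspace Y. f y \<in> (\<Union>\<sigma>\<in>\<Sigma>. C \<inter> geometric_simplex \<sigma>)}"
    by (intro closedin_continuous_map_preimage[OF cont]) simp
  moreover have "{y \<in> topspace Y. f y \<in> (\<Union>\<sigma>\<in>\<Sigma>. C \<inter> geometric_simplex \<sigma>)} = {y \<in> topspace Y. f y \<in> C}"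
    using assms(3) by blast
  ultimately show "closedin Y {y \<in> topspace Y. f y \<in> C}"
    by simp
next
  show "f \<in> topspace Y \<rightarrow> topspace realization"
    using assms(2,3) in_realization by blast
qed

text \<open>One point for each support gives a set \<open>D\<close> that meets every closed simplex
  in finitely many points, since a simplex has finitely many faces. All subsets of \<open>D\<close>
  are then closed, so \<open>D\<close> has no limit point and cannot be an infinite subset of a
  compact set.\<close>

lemma finite_supports_compactin:
  assumes "compactin realization C" shows "finite (support ` C)"
proof (rule ccontr)
  assume "infinite (support ` C)"
  obtain D where D: "D \<subseteq> C" "inj_on support D" "support ` D = support ` C"
    using subset_image_inj[of "support ` C" support C] by auto
  then have inf: "infinite D"
    using \<open>infinite (support ` C)\<close> by (metis finite_imageI)
  have closed: "closedin realization E" if "E \<subseteq> D" for E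
    unfolding closedin_realization
  proof (intro conjI ballI)
    show "E \<subseteq> topspace realization"
      using that D(1) assms compactin_subset_topspace by blast
    fix \<sigma> assume \<sigma>: "\<sigma> \<in> K"
    have "finite (support ` (E \<inter> geometric_simplex \<sigma>))"
      by (rule finite_subset[of _ "Pow \<sigma>"])
        (use finite_simplex[OF \<sigma>] support_of_simplex(1) in \<open>auto dest!: subsetD\<close>)
    moreover have "inj_on support (E \<inter> geometric_simplex \<sigma>)"
      by (rule inj_on_subset[OF D(2)]) (use that in blast)
    ultimately have fin: "finite (E \<inter> geometric_simplex \<sigma>)"
      by (simp add: finite_image_iff)
    have "closed {b}" for b :: "'v \<Rightarrow> real"
    proof -
      have "closed (\<Inter>v. {c. c v = b v})"
        by (intro closed_INT ballI closed_Collect_eq continuous_on_product_coordinates continuous_on_const)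
      also have "(\<Inter>v. {c. c v = b v}) = {b}"
        by (auto simp: fun_eq_iff)
      finally show ?thesis .
    qed
    then have "closed (\<Union>b\<in>E \<inter> geometric_simplex \<sigma>. {b})"
      by (intro closed_UN fin) auto
    then show "closed (E \<inter> geometric_simplex \<sigma>)"
      by simp
  qed
  \<comment> \<open>This open set isolates \<open>b\<close>: it meets \<open>D\<close> at most in
    \<open>b\<close> itself.\<close>
  have *: "openin realization (topspace realization - (D - {b}))" for b
    by (rule openin_diff[OF openin_topspace closed]) blast
  have "b \<notin> realization derived_set_of D" for b
  proof
    assume b: "b \<in> realization derived_set_of D"
    then have "b \<in> topspace realization - (D - {b})"
      by (simp add: in_derived_set_of)
    then obtain y where "y \<noteq> b" "y \<in> D" "y \<in> topspace realization - (D - {b})"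
      using b * unfolding in_derived_set_of by metis
    then show False
      by simp
  qed
  then show False
    using compactin_imp_Bolzano_Weierstrass[OF assms, of D] inf D(1) by blast
qed

lemma finite_supports_pathin:
  assumes "pathin realization f" shows "finite (support ` f ` {0..1})"
proof -
  have "compactin unit_interval {0..1}"
    by (simp add: compactin_subtopology)
  then show ?thesis
    using assms unfolding pathin_def by (intro finite_supports_compactin image_compactin)
qed

text \<open>The union of the closed simplices having \<open>v\<close> as a vertex, expressed through
  the carrier of a point. It contains points whose coordinate at \<open>v\<close> vanishes.\<close>

definition closed_star :: "'v \<Rightarrow> ('v \<Rightarrow> real) set"
  where "closed_star v = {b \<in> topspace realization. insert v (support b) \<in> K}"

lemma closed_star_of_simplex:
  assumes "b \<in> geometric_simplex \<sigma>" "\<sigma> \<in> K" "insert v \<sigma> \<in> K" shows "b \<in> closed_star v"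
proof -
  have "insert v (support b) \<in> K"
    using assms support_of_simplex(1)[of b \<sigma>] finite_simplex by (intro face[OF assms(3)]) auto
  then show ?thesis
    using assms by (auto simp: closed_star_def in_realization)
qed

lemma open_star_subset_closed_star: "open_star K v \<subseteq> closed_star v"
proof
  fix b assume "b \<in> open_star K v"
  then have "v \<in> support b" "b \<in> topspace realization"
    by (auto simp: open_star_def support_def)
  then show "b \<in> closed_star v"
    using in_realizationD(1)[of b] by (simp add: closed_star_def insert_absorb)
qed

lemma openin_open_star: "openin realization (open_star K v)"
  using openin_continuous_map_preimage[OF continuous_map_realization_coordinate, of "{0<..}" K v]
  by (simp add: open_star_def)

lemma pathin_segment:
  assumes "b \<in> geometric_simplex \<sigma>" "c \<in> geometric_simplex \<sigma>" "\<sigma> \<in> K"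
  shows "pathin realization (segment b c)"
  unfolding pathin_def
  by (rule continuous_map_into_realization[of "{\<sigma>}"])
    (use assms geometric_simplex_convex in \<open>auto simp: segment_def intro!: continuous_intros\<close>)

lemma segment_in_closed_star:
  assumes "b \<in> geometric_simplex \<sigma>" "c \<in> geometric_simplex \<sigma>" "insert v \<sigma> \<in> K"
    and "t \<in> {0..1}"
  shows "segment b c t \<in> closed_star v"
proof (rule closed_star_of_simplex[OF _ assms(3)])
  show "segment b c t \<in> geometric_simplex (insert v \<sigma>)"
    using assms geometric_simplex_mono[OF finite_simplex[OF assms(3)], of \<sigma>]
    unfolding segment_def by (intro geometric_simplex_convex) auto
qed (use assms in simp)

text \<open>Waiting at both ends turns \<open>f\<close> into a path that may be coned off towards the vertex \<open>v\<close>
  while keeping the endpoints fixed; the result runs straight from \<open>f 0\<close> to \<open>v\<close> and from there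
  straight to \<open>f 1\<close>.\<close>

lemma closed_star_paths_homotopic:
  assumes "pathin realization f" "\<And>t. t \<in> {0..1} \<Longrightarrow> f t \<in> closed_star v"
    and "pathin realization g" "\<And>t. t \<in> {0..1} \<Longrightarrow> g t \<in> closed_star v"
    and "f 0 = g 0" "f 1 = g 1"
  shows "path_homotopic realization f g"
proof -
  \<comment> \<open>The interval is cut into thirds. On the first, \<open>\<phi>\<close> waits at 0
    while the weight \<open>m\<close> of the vertex grows from 0 to 1; on the second,
    \<open>m\<close> stays 1 while \<open>\<phi>\<close> runs through the interval; on the third,
    \<open>\<phi>\<close> waits at 1 while \<open>m\<close> returns to 0.\<close>
  define \<phi> :: "real \<Rightarrow> real" where "\<phi> t = max 0 (min 1 (3 * t - 1))" for t
  define m :: "real \<Rightarrow> real" where "m t = max 0 (min 1 (min (3 * t) (3 - 3 * t)))" for t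
  define H where "H f = (\<lambda>z w. (1 - fst z * m (snd z)) * f (\<phi> (snd z)) w
      + fst z * m (snd z) * realization_vertex v w)" for f :: "real \<Rightarrow> 'v \<Rightarrow> real"
  have \<phi>: "pathin unit_interval \<phi>" "\<phi> 0 = 0" "\<phi> 1 = 1" "\<And>t. \<phi> t \<in> {0..1}"
    by (auto simp: pathin_def \<phi>_def intro!: continuous_intros)
  have m: "m t \<in> {0..1}" "m 0 = 0" "m 1 = 0" for t
    by (auto simp: m_def)
  have coned: "path_homotopic realization f (\<lambda>t. H f (1, t))"
    if f: "pathin realization f" "\<And>t. t \<in> {0..1} \<Longrightarrow> f t \<in> closed_star v" for f
  proof -
    have "path_homotopic realization (f \<circ> \<phi>) (\<lambda>t. H f (1, t))"
    proof (rule path_homotopicI)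
      show "continuous_map (prod_topology unit_interval unit_interval) realization (H f)"
      proof (rule continuous_map_into_realization)
        show "finite (insert v ` support ` f ` {0..1})"
          by (intro finite_imageI finite_supports_pathin f)
        show "insert v ` support ` f ` {0..1} \<subseteq> K"
          using f(2) by (auto simp: closed_star_def)
        fix z assume z: "z \<in> topspace (prod_topology unit_interval unit_interval)"
        define \<sigma> where "\<sigma> = insert v (support (f (\<phi> (snd z))))"
        have "f (\<phi> (snd z)) \<in> closed_star v"
          by (rule f(2)) (rule \<phi>(4))
        then have \<sigma>: "\<sigma> \<in> K" "f (\<phi> (snd z)) \<in> geometric_simplex (support (f (\<phi> (snd z))))"
          using in_realizationD(2) by (auto simp: closed_star_def \<sigma>_def)
        then have "f (\<phi> (snd z)) \<in> geometric_simplex \<sigma>"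
          using geometric_simplex_mono[OF finite_simplex[OF \<sigma>(1)]] by (auto simp: \<sigma>_def)
        moreover have "realization_vertex v \<in> geometric_simplex \<sigma>"
          using finite_simplex[OF \<sigma>(1)] by (simp add: \<sigma>_def realization_vertex_in_simplex)
        moreover have "0 \<le> fst z * m (snd z)" "fst z * m (snd z) \<le> 1"
          using z m(1)[of "snd z"] by (auto simp: mem_Times_iff mult_le_one)
        ultimately have "H f z \<in> geometric_simplex \<sigma>"
          unfolding H_def by (intro geometric_simplex_convex)
        then show "\<exists>\<sigma>\<in>insert v ` support ` f ` {0..1}. H f z \<in> geometric_simplex \<sigma>"
          using \<phi>(4) unfolding \<sigma>_def by blast
      next
        fix w
        have "continuous_on {0..1} (\<lambda>t. f t w)"
          using continuous_map_compose[OF f(1)[unfolded pathin_def] continuous_map_realization_coordinate[of K w]]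
          by (simp add: o_def)
        then have 1: "continuous_on ({0..1} \<times> {0..1}) (\<lambda>z :: real \<times> real. f (\<phi> (snd z)) w)"
          by (rule continuous_on_compose2)
            (use \<phi>(4) in \<open>auto simp: \<phi>_def intro!: continuous_intros\<close>)
        have 2: "continuous_on ({0..1} \<times> {0..1}) (\<lambda>z :: real \<times> real. m (snd z))"
          by (auto simp: m_def intro!: continuous_intros)
        show "continuous_map (prod_topology unit_interval unit_interval) euclideanreal (\<lambda>z. H f z w)"
          using 1 2 by (auto simp: H_def simp flip: subtopology_Times intro!: continuous_intros)
      qed
    qed (use \<phi> m in \<open>auto simp: H_def\<close>)
    moreover have "path_homotopic realization (f \<circ> linepath 0 1) (f \<circ> \<phi>)"
      by (rule path_homotopic_reparametrize) (use f \<phi> in \<open>auto intro: pathin_linepath\<close>)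
    ultimately show ?thesis
      unfolding comp_linepath_0_1 by (rule path_homotopic_trans[rotated])
  qed
  \<comment> \<open>At time 1 the cone shows only the endpoints: wherever \<open>\<phi> t\<close> is
    neither 0 nor 1, the coefficient \<open>1 - m t\<close> of the path is 0.\<close>
  have "H f (1, t) = H g (1, t)" for t
  proof -
    consider "t \<le> 1/3" | "2/3 \<le> t" | "1/3 < t" "t < 2/3" by linarith
    then have "\<phi> t = 0 \<or> \<phi> t = 1 \<or> m t = 1"
      by cases (auto simp: \<phi>_def m_def)
    then show ?thesis
      using assms(5,6) by (auto simp: H_def)
  qed
  then have "(\<lambda>t. H f (1, t)) = (\<lambda>t. H g (1, t))"
    by simp
  with coned[OF assms(1,2)] coned[OF assms(3,4)] show ?thesis
    by (metis path_homotopic_sym path_homotopic_trans)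
qed

end

text \<open>The target carries no metric, so the Lebesgue number is taken in the compact domain,
  after extending the relatively open preimages to open sets. It serves both the interval and the
  square.\<close>

lemma Lebesgue_number_preimages:
  fixes S :: "'b::metric_space set"
  assumes "compact S" "continuous_map (top_of_set S) Y h"
    and "\<And>x. x \<in> S \<Longrightarrow> \<exists>i\<in>I. h x \<in> W i" and "\<And>i. i \<in> I \<Longrightarrow> openin Y (W i)"
  obtains e where "0 < e" "\<And>x. x \<in> S \<Longrightarrow> \<exists>i\<in>I. \<forall>y\<in>S. dist x y < e \<longrightarrow> h y \<in> W i"
proof -
  have "\<exists>G. open G \<and> {x \<in> S. h x \<in> W i} = S \<inter> G" if "i \<in> I" for i
    using openin_continuous_map_preimage[OF assms(2) assms(4)[OF that]] by (auto simp: openin_open)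
  then obtain G where G: "\<And>i. i \<in> I \<Longrightarrow> open (G i)" "\<And>i. i \<in> I \<Longrightarrow> {x \<in> S. h x \<in> W i} = S \<inter> G i"
    by metis
  have "S \<subseteq> \<Union>(G ` I)"
    using assms(3) G(2) by fastforce
  then obtain e where e: "0 < e" "\<And>x. x \<in> S \<Longrightarrow> \<exists>B\<in>G ` I. ball x e \<subseteq> B"
    by (rule Heine_Borel_lemma[OF assms(1)]) (use G(1) in auto)
  have "\<exists>i\<in>I. \<forall>y\<in>S. dist x y < e \<longrightarrow> h y \<in> W i" if "x \<in> S" for x
  proof -
    obtain i where "i \<in> I" "ball x e \<subseteq> G i"
      using e(2)[OF \<open>x \<in> S\<close>] by auto
    then show ?thesis
      using G(2)[of i] by (fastforce simp: mem_ball)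
  qed
  with e(1) that show ?thesis
    by blast
qed


section \<open>Canonical maps\<close>

lemma simplicial_complex_nerve: "simplicial_complex (nerve \<U>)"
proof
  fix \<sigma> \<tau> assume "\<sigma> \<in> nerve \<U>" "\<tau> \<subseteq> \<sigma>" "\<tau> \<noteq> {}"
  then show "\<tau> \<in> nerve \<U>"
    using Inter_anti_mono[of \<tau> \<sigma>] finite_subset[of \<tau> \<sigma>] unfolding nerve_def by blast
qed (simp add: nerve_def)

section \<open>Supports, members and closed stars\<close>

locale canonical_cover =
  fixes X :: "'a topology" and x0 :: 'a and \<U> :: "'a set set" and U0 :: "'a set"
    and p :: "'a \<Rightarrow> 'a set \<Rightarrow> real"
  assumes path_connected: "path_connected_space X"
    and cover: "open_cover X \<U>" and U0: "U0 \<in> \<U>" "x0 \<in> U0"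
    and path_connected_members: "U \<in> \<U> \<Longrightarrow> path_connectedin X U"
    and canonical: "canonical_map X x0 \<U> U0 p"
begin

sublocale simplicial_complex "nerve \<U>"
  by (rule simplicial_complex_nerve)

lemma member_subset_topspace: "U \<in> \<U> \<Longrightarrow> x \<in> U \<Longrightarrow> x \<in> topspace X"
  using cover by (auto simp: open_cover_def)

lemma basepoint: "x0 \<in> topspace X"
  using member_subset_topspace U0 by blast

lemma continuous_p: "continuous_map X realization p"
  and p_basepoint: "p x0 = realization_vertex U0"
  using canonical by (auto simp: canonical_map_def)

lemma p_in_realization: "x \<in> topspace X \<Longrightarrow> p x \<in> topspace realization"
  using continuous_p by (auto simp: continuous_map_def Pi_iff)

text \<open>The point \<open>x\<close> is the witness for the nonempty intersection; naming it is
  the way simplices are exhibited below.\<close>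

lemma in_nerve:
  assumes "finite \<sigma>" "\<sigma> \<noteq> {}" "\<sigma> \<subseteq> \<U>" "\<And>V. V \<in> \<sigma> \<Longrightarrow> x \<in> V" shows "\<sigma> \<in> nerve \<U>"
proof -
  have "x \<in> \<Inter>\<sigma>"
    using assms(4) by blast
  then show ?thesis
    using assms(1-3) unfolding nerve_def by blast
qed

lemma support_in_cover:
  assumes "b \<in> topspace realization" shows "finite (support b)" "support b \<subseteq> \<U>" "support b \<noteq> {}"
  using in_realizationD(1)[OF assms] by (auto simp: nerve_def)

lemma open_star_iff:
  assumes "b \<in> topspace realization" shows "b \<in> open_star (nerve \<U>) V \<longleftrightarrow> V \<in> support b"
proof -
  have "0 \<le> b V"
    using in_realizationD(2)[OF assms] by (simp add: geometric_simplex_def)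
  then show ?thesis
    using assms by (auto simp: open_star_def support_def)
qed

text \<open>The canonical condition, read in barycentric coordinates.\<close>

lemma mem_of_support_p:
  assumes "x \<in> topspace X" "V \<in> support (p x)" shows "x \<in> V"
  using assms canonical open_star_iff[OF p_in_realization[OF assms(1)], of V]
    support_in_cover(2)[OF p_in_realization[OF assms(1)]]
  by (auto simp: canonical_map_def)

text \<open>The point \<open>x\<close> lies in \<open>U\<close> and in all members of the support of
  \<open>p x\<close>, so it witnesses that these span a simplex. As \<open>U\<close> itself may be
  missing from the support, the open star would be too small.\<close>

lemma p_closed_star:
  assumes "U \<in> \<U>" "x \<in> U" shows "p x \<in> closed_star U"
proof -
  have x: "x \<in> topspace X"
    using assms member_subset_topspace by blast
  then have "insert U (support (p x)) \<in> nerve \<U>"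
    using assms mem_of_support_p[OF x] support_in_cover[OF p_in_realization[OF x]]
    by (intro in_nerve[of _ x]) auto
  then show ?thesis
    by (simp add: closed_star_def p_in_realization[OF x])
qed

lemma path_in_member:
  assumes "U \<in> \<U>" "a \<in> U" "b \<in> U"
  obtains \<gamma> where "pathin (subtopology X U) \<gamma>" "\<gamma> 0 = a" "\<gamma> 1 = b"
  using path_connected_members[OF assms(1)] assms(2,3)
  unfolding path_connectedin_def path_connected_space_def
  by (metis topspace_subtopology_subset)

lemma p_path_in_closed_star:
  assumes "U \<in> \<U>" "pathin (subtopology X U) \<gamma>"
  shows "pathin realization (p \<circ> \<gamma>)" "\<And>t. t \<in> {0..1} \<Longrightarrow> (p \<circ> \<gamma>) t \<in> closed_star U"
  using assms p_closed_star pathin_compose[OF _ continuous_p]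
  by (auto simp: pathin_subtopology)

text \<open>Both paths can be replaced by one that passes through the vertex \<open>U\<close> and stays in the
  intersection of the closed stars of \<open>U\<close> and \<open>V\<close>.\<close>

lemma p_paths_homotopic:
  assumes U: "U \<in> \<U>" "pathin (subtopology X U) \<gamma>" and V: "V \<in> \<U>" "pathin (subtopology X V) \<delta>"
    and ends: "\<gamma> 0 = \<delta> 0" "\<gamma> 1 = \<delta> 1"
  shows "path_homotopic realization (p \<circ> \<gamma>) (p \<circ> \<delta>)"
proof -
  \<comment> \<open>Only the endpoints are known to lie in both members. For such a point
    \<open>x\<close> all vertices in \<open>\<sigma> x\<close> contain \<open>x\<close>, so this is
    a simplex with both \<open>U\<close> and \<open>V\<close> among its vertices.\<close>
  define \<sigma> where "\<sigma> x = insert U (insert V (support (p x)))" for x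
  have mem: "\<gamma> 0 \<in> U" "\<gamma> 1 \<in> U" "\<gamma> 0 \<in> V" "\<gamma> 1 \<in> V"
  proof -
    have "\<gamma> t \<in> U" "\<delta> t \<in> V" if "t \<in> {0..1}" for t
      using U(2) V(2) that by (auto simp only: pathin_subtopology)
    from this[of 0] this[of 1] show "\<gamma> 0 \<in> U" "\<gamma> 1 \<in> U" "\<gamma> 0 \<in> V" "\<gamma> 1 \<in> V"
      by (simp_all add: ends)
  qed
  have \<sigma>: "\<sigma> x \<in> nerve \<U>" "realization_vertex U \<in> geometric_simplex (\<sigma> x)" "p x \<in> geometric_simplex (\<sigma> x)"
    if "x \<in> U" "x \<in> V" for x
  proof -
    have x: "x \<in> topspace X"
      using that U(1) member_subset_topspace by blast
    note px = p_in_realization[OF x]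
    show "\<sigma> x \<in> nerve \<U>"
      using that U V mem_of_support_p[OF x] support_in_cover[OF px]
      by (intro in_nerve[of _ x]) (auto simp: \<sigma>_def)
    then have "finite (\<sigma> x)"
      by (rule finite_simplex)
    then show "realization_vertex U \<in> geometric_simplex (\<sigma> x)" "p x \<in> geometric_simplex (\<sigma> x)"
      using in_realizationD(2)[OF px] geometric_simplex_mono[of "\<sigma> x" "support (p x)"]
      by (auto simp: \<sigma>_def intro: realization_vertex_in_simplex)
  qed
  define q where "q = path_join (segment (p (\<gamma> 0)) (realization_vertex U))
    (segment (realization_vertex U) (p (\<gamma> 1)))"
  note \<sigma>0 = \<sigma>[OF mem(1,3)] and \<sigma>1 = \<sigma>[OF mem(2,4)]
  have q: "pathin realization q" "q 0 = p (\<gamma> 0)" "q 1 = p (\<gamma> 1)"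
    unfolding q_def
    by (simp_all add: pathin_join pathin_segment[OF \<sigma>0(3,2,1)] pathin_segment[OF \<sigma>1(2,3,1)])
  have star: "q t \<in> closed_star W" if W: "W \<in> {U, V}" and t: "t \<in> {0..1}" for t W
  proof -
    have insert: "insert W (\<sigma> x) = \<sigma> x" for x
      using W by (auto simp: \<sigma>_def)
    show ?thesis
      unfolding q_def
    proof (rule path_join_in[OF _ _ t])
      fix t :: real assume t: "t \<in> {0..1}"
      show "segment (p (\<gamma> 0)) (realization_vertex U) t \<in> closed_star W"
        by (rule segment_in_closed_star[OF \<sigma>0(3,2) _ t]) (simp only: insert \<sigma>0)
      show "segment (realization_vertex U) (p (\<gamma> 1)) t \<in> closed_star W"
        by (rule segment_in_closed_star[OF \<sigma>1(2,3) _ t]) (simp only: insert \<sigma>1)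
    qed
  qed
  have "path_homotopic realization (p \<circ> \<gamma>) q"
    by (rule closed_star_paths_homotopic[OF p_path_in_closed_star[OF U] q(1) star]) (simp_all add: q)
  moreover have "path_homotopic realization (p \<circ> \<delta>) q"
    by (rule closed_star_paths_homotopic[OF p_path_in_closed_star[OF V] q(1) star]) (simp_all add: q ends)
  ultimately show ?thesis
    by (meson path_homotopic_sym path_homotopic_trans)
qed

section \<open>Lifting loops from the nerve\<close>

definition vertex_point :: "('a set \<Rightarrow> real) \<Rightarrow> 'a"
  where "vertex_point b = (if b = realization_vertex U0 then x0 else SOME x. x \<in> \<Inter>(support b))"

text \<open>The prescribed value makes lifted loops close up and puts the sides and the top of the
  grid at the basepoint. It respects supports because \<open>x0\<close> lies in
  \<open>U0\<close>.\<close>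

lemma vertex_point_basepoint [simp]: "vertex_point (realization_vertex U0) = x0"
  by (simp add: vertex_point_def)

lemma vertex_point_in_support:
  assumes "b \<in> topspace realization" "V \<in> support b" shows "vertex_point b \<in> V"
proof (cases "b = realization_vertex U0")
  case False
  have "\<Inter>(support b) \<noteq> {}"
    using in_realizationD(1)[OF assms(1)] by (simp add: nerve_def)
  then have "(SOME x. x \<in> \<Inter>(support b)) \<in> \<Inter>(support b)"
    using some_in_eq[of "\<Inter>(support b)"] by blast
  then show ?thesis
    using False assms(2) by (auto simp: vertex_point_def)
qed (use assms U0 in auto)

text \<open>The chosen point lies in every member of the support of \<open>b\<close> and of the
  support of its own image under \<open>p\<close>. Hence the two supports together span a simplex,
  and the segment stays in it.\<close>

lemma segment_to_vertex_point:
  assumes "b \<in> topspace realization"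
  defines "x \<equiv> vertex_point b"
  shows "pathin realization (segment (p x) b)"
    and "V \<in> support b \<Longrightarrow> t \<in> {0..1} \<Longrightarrow> segment (p x) b t \<in> closed_star V"
proof -
  obtain W where "W \<in> support b"
    using support_in_cover(3)[OF assms(1)] by blast
  then have x: "x \<in> topspace X"
    unfolding x_def using vertex_point_in_support[OF assms(1)] support_in_cover(2)[OF assms(1)]
    by (blast intro: member_subset_topspace)
  note px = p_in_realization[OF x]
  define \<sigma> where "\<sigma> = support (p x) \<union> support b"
  have \<sigma>: "\<sigma> \<in> nerve \<U>"
  proof (rule in_nerve[of _ x])
    show "x \<in> V" if "V \<in> \<sigma>" for V
      using that mem_of_support_p[OF x] vertex_point_in_support[OF assms(1)]
      by (auto simp: \<sigma>_def x_def)
  qed (use support_in_cover[OF assms(1)] support_in_cover[OF px] in \<open>auto simp: \<sigma>_def\<close>)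
  have mem: "p x \<in> geometric_simplex \<sigma>" "b \<in> geometric_simplex \<sigma>"
    using in_realizationD(2)[OF px] in_realizationD(2)[OF assms(1)]
      geometric_simplex_mono[OF finite_simplex[OF \<sigma>]] by (auto simp: \<sigma>_def)
  then show "pathin realization (segment (p x) b)"
    using \<sigma> by (rule pathin_segment)
  show "segment (p x) b t \<in> closed_star V" if "V \<in> support b" "t \<in> {0..1}"
  proof (rule segment_in_closed_star[OF mem _ that(2)])
    show "insert V \<sigma> \<in> nerve \<U>"
      using that \<sigma> by (simp add: insert_absorb \<sigma>_def)
  qed
qed

lemma realization_loop_lifts:
  assumes L: "pathin realization L" "L 0 = realization_vertex U0" "L 1 = realization_vertex U0"
  shows "\<exists>\<delta>. pathin X \<delta> \<and> \<delta> 0 = x0 \<and> \<delta> 1 = x0 \<and> path_homotopic realization (p \<circ> \<delta>) L"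
proof -
  have Lt: "L t \<in> topspace realization" if "t \<in> {0..1}" for t
    using path_image_subset_topspace[OF L(1)] that by auto
  have "\<exists>V\<in>\<U>. L t \<in> open_star (nerve \<U>) V" if "t \<in> {0..1}" for t
    using support_in_cover[OF Lt[OF that]] open_star_iff[OF Lt[OF that]] by blast
  then obtain e where e: "0 < e"
    "\<And>x. x \<in> {0..1} \<Longrightarrow> \<exists>V\<in>\<U>. \<forall>y\<in>{0..1}. dist x y < e \<longrightarrow> L y \<in> open_star (nerve \<U>) V"
    using Lebesgue_number_preimages[OF compact_Icc L(1)[unfolded pathin_def], of \<U> "open_star (nerve \<U>)"]
      openin_open_star by blast
  obtain n where n: "inverse (real (Suc n)) < e"
    using reals_Archimedean[OF e(1)] by blast
  define N where "N = Suc n"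
  define t where "t k = real k / real N" for k
  have t: "t k \<in> {0..1}" if "k \<le> N" for k
    using that by (auto simp: t_def N_def)
  have t0: "t 0 = 0" and tN: "t N = 1"
    by (auto simp: t_def N_def)
  have tS: "t (Suc k) = t k + inverse (real N)" for k
    by (simp add: t_def N_def field_simps)
  \<comment> \<open>Invariant: the image of the lift built so far, followed by a correcting segment,
    is the initial piece of \<open>L\<close>. The correction is needed because
    \<open>L (t k)\<close> need not be in the image of \<open>p\<close>.\<close>
  have "\<exists>\<delta>. pathin X \<delta> \<and> \<delta> 0 = x0 \<and> \<delta> 1 = vertex_point (L (t k)) \<and>
      path_homotopic realization (path_join (p \<circ> \<delta>) (segment (p (\<delta> 1)) (L (t k)))) (L \<circ> linepath 0 (t k))"
    if "k \<le> N" for k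
    using that
  proof (induction k)
    case 0
    have "p \<circ> (\<lambda>_. x0) = (\<lambda>_. realization_vertex U0)"
      "path_join (\<lambda>_. realization_vertex U0) (\<lambda>_. realization_vertex U0) = (\<lambda>_. realization_vertex U0)"
      by (auto simp: p_basepoint path_join_def)
    moreover have "realization_vertex U0 \<in> topspace realization"
      using p_in_realization[OF basepoint] by (simp add: p_basepoint)
    ultimately show ?case
      using L basepoint
      by (intro exI[of _ "\<lambda>_. x0"]) (simp add: t0 comp_linepath_same p_basepoint path_homotopic_refl)
  next
    case (Suc k)
    define b where "b = L (t k)"
    define c where "c = L (t (Suc k))"
    have b: "b \<in> topspace realization" and c: "c \<in> topspace realization"
      unfolding b_def c_def using Suc.prems t Lt by auto
    have k: "k \<le> N"
      using Suc.prems by simp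
    obtain \<delta> where \<delta>: "pathin X \<delta>" "\<delta> 0 = x0" "\<delta> 1 = vertex_point b"
      and "path_homotopic realization (path_join (p \<circ> \<delta>) (segment (p (\<delta> 1)) b)) (L \<circ> linepath 0 (t k))"
      using Suc.IH[OF k] unfolding b_def by blast
    then have hom: "path_homotopic realization (path_join (p \<circ> \<delta>) (segment (p (vertex_point b)) b))
         (L \<circ> linepath 0 (t k))"
      by simp
    obtain V where V: "V \<in> \<U>"
      "\<And>y. y \<in> {0..1} \<Longrightarrow> dist (t k) y < e \<Longrightarrow> L y \<in> open_star (nerve \<U>) V"
      using e(2)[OF t[OF k]] by blast
    \<comment> \<open>The ball of radius \<open>e\<close> is centred at the left end
      \<open>t k\<close>; it covers the next piece because the mesh \<open>inverse (real N)\<close>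
      is below \<open>e\<close>.\<close>
    have LV: "L y \<in> open_star (nerve \<U>) V" if "t k \<le> y" "y \<le> t (Suc k)" for y
      using that n t[of k] t[of "Suc k"] Suc.prems
      by (intro V(2)) (auto simp: dist_real_def tS N_def)
    have supp: "V \<in> support b" "V \<in> support c"
      using LV[of "t k"] LV[of "t (Suc k)"] open_star_iff[OF b] open_star_iff[OF c]
      by (auto simp: b_def c_def tS N_def)
    obtain \<gamma> where \<gamma>: "pathin (subtopology X V) \<gamma>" "\<gamma> 0 = vertex_point b" "\<gamma> 1 = vertex_point c"
      using path_in_member[OF V(1)] vertex_point_in_support b c supp by metis
    note pp = p_path_in_closed_star[OF V(1) \<gamma>(1)]
    note sb = segment_to_vertex_point[OF b]
    note sc = segment_to_vertex_point[OF c]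
    define l where "l = L \<circ> linepath (t k) (t (Suc k))"
    have l: "pathin realization l" "l 0 = b" "l 1 = c"
      unfolding l_def b_def c_def
      by (auto intro!: pathin_intros L simp del: atLeastAtMost_iff simp: t Suc.prems Suc_leD)
    have lV: "l s \<in> closed_star V" if "s \<in> {0..1}" for s
    proof -
      have "linepath (t k) (t (Suc k)) s = t k + s * inverse (real N)"
        by (simp add: linepath_def tS algebra_simps)
      moreover have "s * inverse (real N) \<le> 1 * inverse (real N)"
        by (rule mult_right_mono) (use that in auto)
      moreover have "0 \<le> s * inverse (real N)"
        using that by simp
      ultimately have "L (linepath (t k) (t (Suc k)) s) \<in> open_star (nerve \<U>) V"
        by (intro LV) (simp_all add: tS)
      then show ?thesis
        using open_star_subset_closed_star unfolding l_def o_def by blast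
    qed
    have pd: "pathin realization (p \<circ> \<delta>)"
      by (rule pathin_compose[OF \<delta>(1) continuous_p])
    \<comment> \<open>Two ways from \<open>p (vertex_point b)\<close> to \<open>c\<close>: along the
      lifted piece and then the new correction, or along the old correction and then
      \<open>L\<close>. Both stay in the closed star of \<open>V\<close>.\<close>
    have key: "path_homotopic realization (path_join (p \<circ> \<gamma>) (segment (p (vertex_point c)) c))
        (path_join (segment (p (vertex_point b)) b) l)"
    proof (rule closed_star_paths_homotopic)
      fix s :: real assume s: "s \<in> {0..1}"
      show "path_join (p \<circ> \<gamma>) (segment (p (vertex_point c)) c) s \<in> closed_star V"
        by (rule path_join_in[OF _ _ s]) (rule pp(2) sc(2)[OF supp(2)], assumption)+
      show "path_join (segment (p (vertex_point b)) b) l s \<in> closed_star V"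
        by (rule path_join_in[OF _ _ s]) (rule sb(2)[OF supp(1)] lV, assumption)+
    next
      show "pathin realization (path_join (p \<circ> \<gamma>) (segment (p (vertex_point c)) c))"
        by (rule pathin_join[OF pp(1) sc(1)]) (simp add: \<gamma>)
      show "pathin realization (path_join (segment (p (vertex_point b)) b) l)"
        by (rule pathin_join[OF sb(1) l(1)]) (simp add: l)
    qed (simp_all add: \<gamma>(2,3) l(2,3))
    have "path_homotopic realization
        (path_join (p \<circ> path_join \<delta> \<gamma>) (segment (p (vertex_point c)) c))
        (path_join (p \<circ> \<delta>) (path_join (p \<circ> \<gamma>) (segment (p (vertex_point c)) c)))"
      unfolding path_join_compose
      by (rule path_homotopic_assoc[OF pd pp(1) sc(1)]) (simp_all add: \<delta> \<gamma>)
    also have "path_homotopic realization \<dots>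
        (path_join (p \<circ> \<delta>) (path_join (segment (p (vertex_point b)) b) l))"
      by (rule path_homotopic_join_right[OF pd key]) (simp add: \<delta> \<gamma>)
    also have "path_homotopic realization \<dots>
        (path_join (path_join (p \<circ> \<delta>) (segment (p (vertex_point b)) b)) l)"
      by (rule path_homotopic_sym[OF path_homotopic_assoc[OF pd sb(1) l(1)]]) (simp_all add: \<delta> l)
    also have "path_homotopic realization \<dots> (path_join (L \<circ> linepath 0 (t k)) l)"
      by (rule path_homotopic_join_left[OF hom l(1)]) (simp add: l)
    also have "path_homotopic realization \<dots> (L \<circ> linepath 0 (t (Suc k)))"
      unfolding l_def by (rule path_homotopic_join_linepath[OF L(1)]) (use t[OF k] t[OF Suc.prems] in auto)
    finally have "path_homotopic realization
        (path_join (p \<circ> path_join \<delta> \<gamma>) (segment (p (vertex_point c)) c)) (L \<circ> linepath 0 (t (Suc k)))" .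
    moreover have "pathin X (path_join \<delta> \<gamma>)"
      using \<delta> \<gamma> by (intro pathin_join) (auto simp: pathin_subtopology)
    moreover have "path_join \<delta> \<gamma> 0 = x0" "path_join \<delta> \<gamma> 1 = vertex_point c"
      by (simp_all add: \<delta> \<gamma>)
    ultimately show ?case
      unfolding c_def[symmetric] by metis
  qed
  moreover have LN: "L (t N) = realization_vertex U0" "L \<circ> linepath 0 (t N) = L"
    by (simp_all add: tN L comp_linepath_0_1)
  ultimately obtain \<delta> where \<delta>: "pathin X \<delta>" "\<delta> 0 = x0" "\<delta> 1 = vertex_point (L (t N))"
    and hom: "path_homotopic realization (path_join (p \<circ> \<delta>) (segment (p (\<delta> 1)) (L (t N)))) L"
    by (metis order_refl)
  have \<delta>1: "\<delta> 1 = x0"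
    by (simp add: \<delta> LN)
  have "path_homotopic realization (p \<circ> \<delta>) (path_join (p \<circ> \<delta>) (\<lambda>_. realization_vertex U0))"
    by (rule path_homotopic_sym, rule path_homotopic_join_const)
      (simp_all add: pathin_compose[OF \<delta>(1) continuous_p] \<delta>1 p_basepoint)
  also have "path_homotopic realization \<dots> L"
    using hom unfolding LN \<delta>1 p_basepoint segment_simps .
  finally show ?thesis
    using \<delta> \<delta>1 by blast
qed

end


section \<open>Thick Spanier groups\<close>

context canonical_cover
begin

text \<open>\<open>T\<close> stands for the transport of paths into the quotient of the fundamental group by the thick
  Spanier group.\<close>

lemma transport_of_null_homotopic:
  fixes Q (structure)
  assumes "group Q"
    and T_closed: "\<And>\<gamma>. pathin X \<gamma> \<Longrightarrow> T \<gamma> \<in> carrier Q"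
    and T_join: "\<And>\<gamma> \<delta>. pathin X \<gamma> \<Longrightarrow> pathin X \<delta> \<Longrightarrow> \<gamma> 1 = \<delta> 0 \<Longrightarrow> T (path_join \<gamma> \<delta>) = T \<gamma> \<otimes> T \<delta>"
    and T_homotopic: "\<And>\<gamma> \<delta>. path_homotopic X \<gamma> \<delta> \<Longrightarrow> T \<gamma> = T \<delta>"
    and T_thick: "\<And>U V \<gamma> \<delta>. U \<in> \<U> \<Longrightarrow> V \<in> \<U> \<Longrightarrow> pathin (subtopology X U) \<gamma> \<Longrightarrow>
      pathin (subtopology X V) \<delta> \<Longrightarrow> \<gamma> 0 = \<delta> 0 \<Longrightarrow> \<gamma> 1 = \<delta> 1 \<Longrightarrow> T \<gamma> = T \<delta>"
    and f: "pathin X f" "f 0 = x0" "f 1 = x0"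
    and null: "path_homotopic realization (p \<circ> f) (\<lambda>_. realization_vertex U0)"
  shows "T f = \<one>"
proof -
  interpret group Q by fact
  \<comment> \<open>The common value of \<open>T\<close> on paths from \<open>a\<close> to
    \<open>b\<close> inside members; it is arbitrary when there is no such path.\<close>
  define E where "E a b = T (SOME \<gamma>. \<exists>U\<in>\<U>. pathin (subtopology X U) \<gamma> \<and> \<gamma> 0 = a \<and> \<gamma> 1 = b)" for a b
  have E_eq: "T \<gamma> = E (\<gamma> 0) (\<gamma> 1)" if "U \<in> \<U>" "pathin (subtopology X U) \<gamma>" for U \<gamma>
  proof -
    have "\<exists>\<delta>. \<exists>U\<in>\<U>. pathin (subtopology X U) \<delta> \<and> \<delta> 0 = \<gamma> 0 \<and> \<delta> 1 = \<gamma> 1"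
      using that by blast
    from someI_ex[OF this] obtain V where V: "V \<in> \<U>"
      "pathin (subtopology X V) (SOME \<delta>. \<exists>U\<in>\<U>. pathin (subtopology X U) \<delta> \<and> \<delta> 0 = \<gamma> 0 \<and> \<delta> 1 = \<gamma> 1)"
      "(SOME \<delta>. \<exists>U\<in>\<U>. pathin (subtopology X U) \<delta> \<and> \<delta> 0 = \<gamma> 0 \<and> \<delta> 1 = \<gamma> 1) 0 = \<gamma> 0"
      "(SOME \<delta>. \<exists>U\<in>\<U>. pathin (subtopology X U) \<delta> \<and> \<delta> 0 = \<gamma> 0 \<and> \<delta> 1 = \<gamma> 1) 1 = \<gamma> 1"
      by blast
    show ?thesis
      unfolding E_def by (rule T_thick[OF that(1) V(1) that(2) V(2)]) (simp_all only: V(3,4))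
  qed
  have member_path: "pathin X \<gamma>" if "pathin (subtopology X U) \<gamma>" for \<gamma> U
    using that by (simp add: pathin_subtopology)
  have E_closed: "E a b \<in> carrier Q" if ab: "U \<in> \<U>" "a \<in> U" "b \<in> U" for a b U
  proof -
    obtain \<gamma> where \<gamma>: "pathin (subtopology X U) \<gamma>" "\<gamma> 0 = a" "\<gamma> 1 = b"
      using path_in_member[OF ab] by metis
    show ?thesis
      using E_eq[OF ab(1) \<gamma>(1)] T_closed[OF member_path[OF \<gamma>(1)]] by (simp add: \<gamma>)
  qed
  \<comment> \<open>All three points are required in one member, so that the join of the two paths
    is again a path inside a member.\<close>
  have E_mult: "E a b \<otimes> E b c = E a c" if U: "U \<in> \<U>" and abc: "a \<in> U" "b \<in> U" "c \<in> U" for a b c U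
  proof -
    obtain \<gamma> where \<gamma>: "pathin (subtopology X U) \<gamma>" "\<gamma> 0 = a" "\<gamma> 1 = b"
      using path_in_member[OF U abc(1,2)] by metis
    obtain \<delta> where \<delta>: "pathin (subtopology X U) \<delta>" "\<delta> 0 = b" "\<delta> 1 = c"
      using path_in_member[OF U abc(2,3)] by metis
    have "pathin (subtopology X U) (path_join \<gamma> \<delta>)"
      by (rule pathin_join[OF \<gamma>(1) \<delta>(1)]) (simp add: \<gamma> \<delta>)
    from E_eq[OF U this] have "E a c = T (path_join \<gamma> \<delta>)"
      by (simp add: \<gamma> \<delta>)
    also have "\<dots> = T \<gamma> \<otimes> T \<delta>"
      by (rule T_join) (simp_all add: \<gamma> \<delta> member_path[OF \<gamma>(1)] member_path[OF \<delta>(1)])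
    finally show ?thesis
      using E_eq[OF U \<gamma>(1)] E_eq[OF U \<delta>(1)] by (simp add: \<gamma> \<delta>)
  qed
  \<comment> \<open>An idempotent of a group is its identity.\<close>
  have E_x0: "E x0 x0 = \<one>"
    using E_mult[OF U0(1) U0(2) U0(2) U0(2)] E_closed[OF U0(1) U0(2) U0(2)] by (simp add: l_cancel_one)

  let ?I2 = "{0..1} \<times> {0..1} :: (real \<times> real) set"
  obtain h where h: "continuous_map (prod_topology unit_interval unit_interval) realization h"
    and h_bottom: "\<And>t. h (0, t) = p (f t)" and h_top: "\<And>t. h (1, t) = realization_vertex U0"
    and h_sides: "\<And>s. s \<in> {0..1} \<Longrightarrow> h (s, 0) = realization_vertex U0"
      "\<And>s. s \<in> {0..1} \<Longrightarrow> h (s, 1) = realization_vertex U0"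
    using path_homotopicE[OF null] f p_basepoint unfolding o_def by metis
  have h_cont: "continuous_map (top_of_set ?I2) realization h"
    using h by (simp flip: subtopology_Times)
  have h_in: "h z \<in> topspace realization" if "z \<in> ?I2" for z
    using h_cont that by (auto simp: continuous_map_def Pi_iff)
  have "\<exists>V\<in>\<U>. h z \<in> open_star (nerve \<U>) V" if "z \<in> ?I2" for z
    using support_in_cover[OF h_in[OF that]] open_star_iff[OF h_in[OF that]] by blast
  then obtain e where e: "0 < e"
    "\<And>z. z \<in> ?I2 \<Longrightarrow> \<exists>V\<in>\<U>. \<forall>y\<in>?I2. dist z y < e \<longrightarrow> h y \<in> open_star (nerve \<U>) V"
    using Lebesgue_number_preimages[OF compact_Times[OF compact_Icc compact_Icc] h_cont,
        of \<U> "open_star (nerve \<U>)"] openin_open_star by blast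
  \<comment> \<open>Across a cell each coordinate moves by at most the mesh, and the distance in the
    square is at most the sum of the two moves; hence the factor 2.\<close>
  obtain n where n: "inverse (real (Suc n)) < e / 2"
    using reals_Archimedean[of "e / 2"] e(1) by auto
  define N where "N = Suc n"
  define t where "t k = real k / real N" for k
  have t: "t k \<in> {0..1}" if "k \<le> N" for k
    using that by (auto simp: t_def N_def)
  have t0: "t 0 = 0" and tN: "t N = 1"
    by (auto simp: t_def N_def)
  have tS: "t (Suc k) = t k + inverse (real N)" for k
    by (simp add: t_def N_def field_simps)
  have N: "0 < inverse (real N)" "inverse (real N) < e / 2" "N \<noteq> 0"
    using n by (simp_all add: N_def)

  \<comment> \<open>Index \<open>i\<close> follows the path parameter and \<open>j\<close> the
    homotopy time, so \<open>h\<close> receives them in reversed order. The bottom row keeps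
    \<open>f\<close> itself, since the point chosen for \<open>p (f (t i))\<close> may differ from
    \<open>f (t i)\<close>.\<close>
  define x where "x i j = (if j = 0 then f (t i) else vertex_point (h (t j, t i)))" for i j
  have x_left: "x 0 j = x0" and x_right: "x N j = x0" if "j \<le> N" for j
    using h_sides[OF t[OF that]] f by (simp_all add: x_def t0 tN)
  have x_top: "x i N = x0" for i
    by (simp add: x_def tN h_top N)
  \<comment> \<open>In the bottom row the member must contain the whole piece of \<open>f\<close>
    between two grid points, for this piece has to be a path inside a member.\<close>
  have cell: "\<exists>V\<in>\<U>. (\<forall>i'\<in>{i, Suc i}. \<forall>j'\<in>{j, Suc j}. x i' j' \<in> V) \<and>
      (j = 0 \<longrightarrow> f ` {t i..t (Suc i)} \<subseteq> V)" if ij: "i < N" "j < N" for i j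
  proof -
    have ij_le: "i \<le> N" "Suc i \<le> N" "j \<le> N" "Suc j \<le> N"
      using ij by auto
    have "(t j, t i) \<in> ?I2"
      using t[OF ij_le(1)] t[OF ij_le(3)] by simp
    from e(2)[OF this] obtain V where V: "V \<in> \<U>"
      and V_near: "\<And>y. y \<in> ?I2 \<Longrightarrow> dist (t j, t i) y < e \<Longrightarrow> h y \<in> open_star (nerve \<U>) V"
      by blast
    have near: "(a, b) \<in> ?I2 \<and> h (a, b) \<in> open_star (nerve \<U>) V"
      if ab: "t j \<le> a" "a \<le> t (Suc j)" "t i \<le> b" "b \<le> t (Suc i)" for a b
    proof -
      have I2: "(a, b) \<in> ?I2"
        using ab t[OF ij_le(1)] t[OF ij_le(2)] t[OF ij_le(3)] t[OF ij_le(4)] by auto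
      have "dist (t j, t i) (a, b) \<le> \<bar>t j - a\<bar> + \<bar>t i - b\<bar>"
        unfolding dist_Pair_Pair dist_real_def by (metis abs_abs sqrt_sum_squares_le_sum_abs)
      also have "\<dots> < e"
        using ab N by (simp add: tS)
      finally show ?thesis
        using V_near[OF I2] I2 by blast
    qed
    \<comment> \<open>Here \<open>p (f b)\<close> equals \<open>h (0, b)\<close> and lies in the
      open star of \<open>V\<close>, so the canonical condition puts \<open>f b\<close> into
      \<open>V\<close>.\<close>
    have f_in: "f b \<in> V" if "j = 0" "t i \<le> b" "b \<le> t (Suc i)" for b
    proof -
      have "b \<in> {0..1}"
        using that t[OF ij_le(1)] t[OF ij_le(2)] by auto
      then have fb: "f b \<in> topspace X"
        using path_image_subset_topspace[OF f(1)] by auto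
      have "p (f b) \<in> open_star (nerve \<U>) V"
        using near[of 0 b] that N by (simp add: t0 h_bottom tS)
      then show ?thesis
        using mem_of_support_p[OF fb] open_star_iff[OF p_in_realization[OF fb]] by blast
    qed
    have "x i' j' \<in> V" if i'j': "i' \<in> {i, Suc i}" "j' \<in> {j, Suc j}" for i' j'
    proof (cases "j' = 0")
      case True
      then show ?thesis
        using f_in[of "t i'"] i'j' N by (auto simp: x_def tS)
    next
      case False
      have "(t j', t i') \<in> ?I2" "h (t j', t i') \<in> open_star (nerve \<U>) V"
        using near[of "t j'" "t i'"] i'j' N by (auto simp: tS)
      then show ?thesis
        using False vertex_point_in_support[OF h_in] open_star_iff[OF h_in]
        by (simp add: x_def)
    qed
    then show ?thesis
      using V f_in by (intro bexI[of _ V]) auto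
  qed

  \<comment> \<open>The product of the first \<open>k\<close> edges of row \<open>j\<close>.\<close>
  define R where "R j k = rec_nat \<one> (\<lambda>i r. r \<otimes> E (x i j) (x (Suc i) j)) k" for j k
  have R_simps: "R j 0 = \<one>" "R j (Suc k) = R j k \<otimes> E (x k j) (x (Suc k) j)" for j k
    by (simp_all add: R_def)
  \<comment> \<open>Cells are crossed from left to right, exchanging the two edge paths between
    opposite corners. The carrier facts are part of the induction because \<open>E\<close> is known
    to lie in the group only for points of a common member.\<close>
  have slide: "R j k \<otimes> E (x k j) (x k (Suc j)) = E (x 0 j) (x 0 (Suc j)) \<otimes> R (Suc j) k \<and>
      R j k \<in> carrier Q \<and> R (Suc j) k \<in> carrier Q \<and> E (x 0 j) (x 0 (Suc j)) \<in> carrier Q"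
    if "j < N" "k \<le> N" for j k
    using that(2)
  proof (induction k)
    case 0
    obtain V where "V \<in> \<U>" "x 0 j \<in> V" "x 0 (Suc j) \<in> V"
      using cell[of 0 j] \<open>j < N\<close> by (auto simp: N_def)
    then show ?case
      using E_closed by (simp add: R_simps)
  next
    case (Suc k)
    then have IH: "R j k \<otimes> E (x k j) (x k (Suc j)) = E (x 0 j) (x 0 (Suc j)) \<otimes> R (Suc j) k"
      "R j k \<in> carrier Q" "R (Suc j) k \<in> carrier Q" "E (x 0 j) (x 0 (Suc j)) \<in> carrier Q"
      by auto
    obtain V where V: "V \<in> \<U>" "x k j \<in> V" "x k (Suc j) \<in> V" "x (Suc k) j \<in> V" "x (Suc k) (Suc j) \<in> V"
      using cell[of k j] Suc.prems \<open>j < N\<close> by auto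
    note closed = E_closed[OF V(1)] V
    have "R j (Suc k) \<otimes> E (x (Suc k) j) (x (Suc k) (Suc j))
        = R j k \<otimes> (E (x k j) (x (Suc k) j) \<otimes> E (x (Suc k) j) (x (Suc k) (Suc j)))"
      using IH closed by (simp add: R_simps m_assoc)
    also have "\<dots> = R j k \<otimes> (E (x k j) (x k (Suc j)) \<otimes> E (x k (Suc j)) (x (Suc k) (Suc j)))"
      by (simp only: E_mult[OF V(1,2,4,5)] E_mult[OF V(1,2,3,5)])
    also have "\<dots> = (R j k \<otimes> E (x k j) (x k (Suc j))) \<otimes> E (x k (Suc j)) (x (Suc k) (Suc j))"
      using IH(2) closed by (simp add: m_assoc)
    also have "\<dots> = E (x 0 j) (x 0 (Suc j)) \<otimes> R (Suc j) (Suc k)"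
      unfolding IH(1) R_simps using IH(2-) closed by (simp add: m_assoc)
    finally show ?case
      using IH closed by (simp add: R_simps)
  qed
  \<comment> \<open>The outer vertical edges join \<open>x0\<close> to itself and are
    trivial.\<close>
  have row: "R j N = R (Suc j) N" if "j < N" for j
  proof -
    have "R j N \<otimes> \<one> = \<one> \<otimes> R (Suc j) N" "R j N \<in> carrier Q" "R (Suc j) N \<in> carrier Q"
      using slide[OF that order_refl] that by (simp_all add: x_left x_right E_x0)
    then show ?thesis
      by (metis l_one r_one)
  qed
  have "R 0 N = R j N" if "j \<le> N" for j
    using that by (induction j) (simp_all add: row)
  then have "R 0 N = R N N"
    by simp
  also have "R N k = \<one>" for k
    by (induction k) (simp_all add: R_simps x_top E_x0)
  finally have R0: "R 0 N = \<one>" .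

  \<comment> \<open>The bottom row spells out \<open>f\<close>: by \<open>E_eq\<close>, each of its
    edges is the value of \<open>T\<close> on the actual piece of \<open>f\<close>.\<close>
  have "T (f \<circ> linepath 0 (t k)) = R 0 k" if "k \<le> N" for k
    using that
  proof (induction k)
    case 0
    have "pathin (subtopology X U0) (\<lambda>_. x0)"
      using basepoint U0 by simp
    from E_eq[OF U0(1) this] show ?case
      using f by (simp add: t0 comp_linepath_same R_simps E_x0)
  next
    case (Suc k)
    then have k: "k \<le> N" "k < N"
      by auto
    define l where "l = f \<circ> linepath (t k) (t (Suc k))"
    obtain V where V: "V \<in> \<U>" "f ` {t k..t (Suc k)} \<subseteq> V"
      using cell[of k 0] k by (auto simp: N_def)
    have l: "pathin X l"
      unfolding l_def by (intro pathin_reparametrize[OF f(1)] pathin_linepath t k Suc.prems)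
    have "l s \<in> V" if s: "s \<in> {0..1}" for s
    proof -
      have "linepath (t k) (t (Suc k)) s = t k + s * inverse (real N)"
        by (simp add: linepath_def tS algebra_simps)
      moreover have "s * inverse (real N) \<le> 1 * inverse (real N)"
        by (rule mult_right_mono) (use s N in auto)
      moreover have "0 \<le> s * inverse (real N)"
        using s by simp
      ultimately have "linepath (t k) (t (Suc k)) s \<in> {t k..t (Suc k)}"
        by (simp add: tS)
      then show ?thesis
        using V(2) unfolding l_def o_def by blast
    qed
    then have "pathin (subtopology X V) l"
      using l by (simp add: pathin_subtopology)
    from E_eq[OF V(1) this] have Tl: "T l = E (x k 0) (x (Suc k) 0)"
      by (simp add: l_def x_def)
    have lk: "pathin X (f \<circ> linepath 0 (t k))"
      by (rule pathin_reparametrize[OF f(1) pathin_linepath]) (use t[OF k(1)] in auto)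
    have "T (f \<circ> linepath 0 (t (Suc k))) = T (path_join (f \<circ> linepath 0 (t k)) l)"
      unfolding l_def
      by (rule T_homotopic[OF path_homotopic_sym[OF path_homotopic_join_linepath[OF f(1)]]])
        (use t[OF k(1)] t[OF Suc.prems] in auto)
    also have "\<dots> = T (f \<circ> linepath 0 (t k)) \<otimes> T l"
      by (rule T_join[OF lk l]) (simp add: l_def)
    finally show ?case
      unfolding R_simps Suc.IH[OF k(1)] Tl .
  qed
  from this[OF order_refl] show ?thesis
    by (simp add: R0 tN comp_linepath_0_1)
qed

end

section \<open>Generators and normality of the thick Spanier group\<close>

lemma thick_spanier_generator:
  assumes "pathin X \<alpha>" "pathin X \<gamma>1" "pathin X \<gamma>2"
    and "\<gamma>1 0 = \<alpha> 1" "\<gamma>2 1 = \<alpha> 1" "\<gamma>1 1 = \<gamma>2 0"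
  shows "path_class_mult X (path_class_mult X (path_class_mult X
      (path_class X \<alpha>) (path_class X \<gamma>1)) (path_class X \<gamma>2)) (path_class X (path_reverse \<alpha>))
    = path_class X (path_join (path_join (path_join \<alpha> \<gamma>1) \<gamma>2) (path_reverse \<alpha>))"
  using assms by (simp add: path_class_mult pathin_join pathin_reverse)

text \<open>Each generator becomes the class of one explicit loop, so that conjugation and the
  induced map can be computed on representatives.\<close>

lemma thick_spanier_generators_eq:
  "thick_spanier_generators X \<U> x0 =
    {path_class X (path_join (path_join (path_join \<alpha> \<gamma>1) \<gamma>2) (path_reverse \<alpha>)) | \<alpha> \<gamma>1 \<gamma>2 U1 U2.
      pathin X \<alpha> \<and> \<alpha> 0 = x0 \<and> U1 \<in> \<U> \<and> U2 \<in> \<U> \<and>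
      pathin (subtopology X U1) \<gamma>1 \<and> pathin (subtopology X U2) \<gamma>2 \<and>
      \<gamma>1 0 = \<alpha> 1 \<and> \<gamma>2 1 = \<alpha> 1 \<and> \<gamma>1 1 = \<gamma>2 0}" (is "_ = ?S")
proof
  show "thick_spanier_generators X \<U> x0 \<subseteq> ?S"
  proof
    fix c assume "c \<in> thick_spanier_generators X \<U> x0"
    then obtain \<alpha> \<gamma>1 \<gamma>2 U1 U2 where c: "c = path_class_mult X (path_class_mult X (path_class_mult X
        (path_class X \<alpha>) (path_class X \<gamma>1)) (path_class X \<gamma>2)) (path_class X (path_reverse \<alpha>))"
      and *: "pathin X \<alpha>" "\<alpha> 0 = x0" "U1 \<in> \<U>" "U2 \<in> \<U>" "pathin (subtopology X U1) \<gamma>1"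
      "pathin (subtopology X U2) \<gamma>2" "\<gamma>1 0 = \<alpha> 1" "\<gamma>2 1 = \<alpha> 1" "\<gamma>1 1 = \<gamma>2 0"
      unfolding thick_spanier_generators_def by blast
    have "c = path_class X (path_join (path_join (path_join \<alpha> \<gamma>1) \<gamma>2) (path_reverse \<alpha>))"
      unfolding c using * by (intro thick_spanier_generator) (simp_all add: pathin_subtopology)
    with * show "c \<in> ?S"
      by blast
  qed
  show "?S \<subseteq> thick_spanier_generators X \<U> x0"
  proof
    fix c assume "c \<in> ?S"
    then obtain \<alpha> \<gamma>1 \<gamma>2 U1 U2
      where c: "c = path_class X (path_join (path_join (path_join \<alpha> \<gamma>1) \<gamma>2) (path_reverse \<alpha>))"
      and *: "pathin X \<alpha>" "\<alpha> 0 = x0" "U1 \<in> \<U>" "U2 \<in> \<U>" "pathin (subtopology X U1) \<gamma>1"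
      "pathin (subtopology X U2) \<gamma>2" "\<gamma>1 0 = \<alpha> 1" "\<gamma>2 1 = \<alpha> 1" "\<gamma>1 1 = \<gamma>2 0"
      by blast
    have "c = path_class_mult X (path_class_mult X (path_class_mult X
        (path_class X \<alpha>) (path_class X \<gamma>1)) (path_class X \<gamma>2)) (path_class X (path_reverse \<alpha>))"
      unfolding c using * by (intro thick_spanier_generator[symmetric]) (simp_all add: pathin_subtopology)
    with * show "c \<in> thick_spanier_generators X \<U> x0"
      unfolding thick_spanier_generators_def by blast
  qed
qed

lemma thick_spanier_generators_subset:
  "thick_spanier_generators X \<U> x0 \<subseteq> carrier (fundamental_group X x0)"
proof
  fix c assume "c \<in> thick_spanier_generators X \<U> x0"
  then obtain \<alpha> \<gamma>1 \<gamma>2 U1 U2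
    where c: "c = path_class X (path_join (path_join (path_join \<alpha> \<gamma>1) \<gamma>2) (path_reverse \<alpha>))"
      and *: "pathin X \<alpha>" "\<alpha> 0 = x0" "U1 \<in> \<U>" "U2 \<in> \<U>" "pathin (subtopology X U1) \<gamma>1"
      "pathin (subtopology X U2) \<gamma>2" "\<gamma>1 0 = \<alpha> 1" "\<gamma>2 1 = \<alpha> 1" "\<gamma>1 1 = \<gamma>2 0"
    unfolding thick_spanier_generators_eq by blast
  show "c \<in> carrier (fundamental_group X x0)"
    unfolding c using *
    by (intro path_class_in_carrier) (simp_all add: pathin_subtopology pathin_join pathin_reverse)
qed

lemma carrier_thick_spanier_group:
  "carrier (thick_spanier_group X \<U> x0) = generate (fundamental_group X x0) (thick_spanier_generators X \<U> x0)"
  using thick_spanier_generators_subset[of X \<U> x0]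
  by (simp add: thick_spanier_group_def carrier_subgroup_generated Int_absorb1)

text \<open>Conjugating by the class of \<open>\<beta>\<close> replaces the tail
  \<open>\<alpha>\<close> of a generator by \<open>path_join \<beta> \<alpha>\<close>, so the
  generating set is itself closed under conjugation.\<close>

lemma thick_spanier_group_normal:
  assumes "x0 \<in> topspace X"
  shows "carrier (thick_spanier_group X \<U> x0) \<lhd> fundamental_group X x0"
proof -
  interpret group "fundamental_group X x0"
    by (rule group_fundamental_group[OF assms])
  show ?thesis
    unfolding carrier_thick_spanier_group
  proof (rule normal_generateI[OF thick_spanier_generators_subset])
    fix c g assume "c \<in> thick_spanier_generators X \<U> x0" "g \<in> carrier (fundamental_group X x0)"
    then obtain \<beta> \<alpha> \<gamma>1 \<gamma>2 U1 U2
      where c: "c = path_class X (path_join (path_join (path_join \<alpha> \<gamma>1) \<gamma>2) (path_reverse \<alpha>))"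
        and *: "pathin X \<alpha>" "\<alpha> 0 = x0" "U1 \<in> \<U>" "U2 \<in> \<U>" "pathin (subtopology X U1) \<gamma>1"
        "pathin (subtopology X U2) \<gamma>2" "\<gamma>1 0 = \<alpha> 1" "\<gamma>2 1 = \<alpha> 1" "\<gamma>1 1 = \<gamma>2 0"
        and g: "g = path_class X \<beta>" and \<beta>: "pathin X \<beta>" "\<beta> 0 = x0" "\<beta> 1 = x0"
      unfolding thick_spanier_generators_eq fundamental_group_simps by blast
    \<comment> \<open>The new generator without its return path, bracketed as in
      \<open>thick_spanier_generators_eq\<close>.\<close>
    let ?Z = "path_join (path_join (path_join \<beta> \<alpha>) \<gamma>1) \<gamma>2"
    have paths: "pathin X \<gamma>1" "pathin X \<gamma>2"
      using * by (simp_all add: pathin_subtopology)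
    note [simp] = pathin_join pathin_reverse * \<beta> paths
    have "path_homotopic X (path_join \<beta> (path_join (path_join (path_join \<alpha> \<gamma>1) \<gamma>2) (path_reverse \<alpha>)))
        (path_join (path_join \<beta> (path_join (path_join \<alpha> \<gamma>1) \<gamma>2)) (path_reverse \<alpha>))"
      by (rule path_homotopic_sym, rule path_homotopic_assoc) simp_all
    also have "path_homotopic X \<dots> (path_join ?Z (path_reverse \<alpha>))"
    proof (rule path_homotopic_join_left)
      have "path_homotopic X (path_join \<beta> (path_join (path_join \<alpha> \<gamma>1) \<gamma>2))
          (path_join (path_join \<beta> (path_join \<alpha> \<gamma>1)) \<gamma>2)"
        by (rule path_homotopic_sym, rule path_homotopic_assoc) simp_all
      also have "path_homotopic X \<dots> ?Z"
        by (rule path_homotopic_join_left, rule path_homotopic_sym, rule path_homotopic_assoc) simp_all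
      finally show "path_homotopic X (path_join \<beta> (path_join (path_join \<alpha> \<gamma>1) \<gamma>2)) ?Z" .
    qed simp_all
    finally have "path_homotopic X
        (path_join (path_join \<beta> (path_join (path_join (path_join \<alpha> \<gamma>1) \<gamma>2) (path_reverse \<alpha>))) (path_reverse \<beta>))
        (path_join (path_join ?Z (path_reverse \<alpha>)) (path_reverse \<beta>))"
      by (rule path_homotopic_join_left) simp_all
    also have "path_homotopic X \<dots> (path_join ?Z (path_join (path_reverse \<alpha>) (path_reverse \<beta>)))"
      by (rule path_homotopic_assoc) simp_all
    also have "path_homotopic X \<dots> (path_join ?Z (path_reverse (path_join \<beta> \<alpha>)))"
      by (rule path_homotopic_join_right, simp, rule path_homotopic_sym, rule path_homotopic_reverse_of_join) simp_all
    finally have hom: "path_homotopic X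
        (path_join (path_join \<beta> (path_join (path_join (path_join \<alpha> \<gamma>1) \<gamma>2) (path_reverse \<alpha>))) (path_reverse \<beta>))
        (path_join ?Z (path_reverse (path_join \<beta> \<alpha>)))" .
    have "g \<otimes>\<^bsub>fundamental_group X x0\<^esub> c \<otimes>\<^bsub>fundamental_group X x0\<^esub> inv\<^bsub>fundamental_group X x0\<^esub> g
        = path_class X (path_join ?Z (path_reverse (path_join \<beta> \<alpha>)))"
      unfolding c g inv_fundamental_group[OF assms \<beta>] fundamental_group_simps
      by (simp add: path_class_mult path_class_eq[OF hom])
    moreover have "\<dots> \<in> thick_spanier_generators X \<U> x0"
      unfolding thick_spanier_generators_eq
      by (intro CollectI exI[of _ "path_join \<beta> \<alpha>"] exI[of _ \<gamma>1] exI[of _ \<gamma>2] exI[of _ U1] exI[of _ U2])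
        (simp del: paths)
    ultimately show "g \<otimes>\<^bsub>fundamental_group X x0\<^esub> c \<otimes>\<^bsub>fundamental_group X x0\<^esub> inv\<^bsub>fundamental_group X x0\<^esub> g
        \<in> thick_spanier_generators X \<U> x0"
      by simp
  qed
qed

section \<open>Kernel, image and exactness\<close>

context canonical_cover
begin

text \<open>Applies \<open>transport_of_null_homotopic\<close> to the quotient by the thick Spanier
  group. Path connectedness of \<open>X\<close> supplies tails from \<open>x0\<close> to all points,
  and a path is sent to the coset of the loop they complete.\<close>

lemma kernel_subset_thick_spanier_group:
  assumes f: "pathin X f" "f 0 = x0" "f 1 = x0"
    and null: "path_homotopic realization (p \<circ> f) (\<lambda>_. realization_vertex U0)"
  shows "path_class X f \<in> carrier (thick_spanier_group X \<U> x0)"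
proof -
  define G where "G = fundamental_group X x0"
  define H where "H = carrier (thick_spanier_group X \<U> x0)"
  interpret G: group G
    unfolding G_def by (rule group_fundamental_group[OF basepoint])
  interpret normal H G
    unfolding G_def H_def by (rule thick_spanier_group_normal[OF basepoint])
  interpret Q: group "G Mod H"
    by (rule factorgroup_is_group)
  \<comment> \<open>The tail at \<open>x0\<close> is chosen constant, so that the loop
    \<open>f\<close> is sent to the coset of its own class.\<close>
  have "\<exists>\<alpha>. pathin X \<alpha> \<and> \<alpha> 0 = x0 \<and> \<alpha> 1 = a \<and> (a = x0 \<longrightarrow> \<alpha> = (\<lambda>_. x0))" if "a \<in> topspace X" for a
  proof (cases "a = x0")
    case True
    then show ?thesis
      using basepoint by (intro exI[of _ "\<lambda>_. x0"]) simp
  next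
    case False
    then show ?thesis
      using path_connected basepoint that unfolding path_connected_space_def by blast
  qed
  then obtain A where A: "\<And>a. a \<in> topspace X \<Longrightarrow> pathin X (A a)"
    "\<And>a. a \<in> topspace X \<Longrightarrow> A a 0 = x0" "\<And>a. a \<in> topspace X \<Longrightarrow> A a 1 = a"
    and A0: "A x0 = (\<lambda>_. x0)"
    using basepoint by metis
  define loop where "loop \<gamma> = path_join (path_join (A (\<gamma> 0)) \<gamma>) (path_reverse (A (\<gamma> 1)))" for \<gamma>
  define \<tau> where "\<tau> \<gamma> = path_class X (loop \<gamma>)" for \<gamma>
  define T where "T \<gamma> = H #>\<^bsub>G\<^esub> \<tau> \<gamma>" for \<gamma>
  note [simp] = pathin_join pathin_reverse path_start_in_topspace path_finish_in_topspace A
  have loop: "pathin X (loop \<gamma>)" "loop \<gamma> 0 = x0" "loop \<gamma> 1 = x0" if "pathin X \<gamma>" for \<gamma>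
    using that by (simp_all add: loop_def)
  have \<tau>_closed: "\<tau> \<gamma> \<in> carrier G" if "pathin X \<gamma>" for \<gamma>
    unfolding G_def \<tau>_def by (intro path_class_in_carrier loop that)
  have loop_join: "path_homotopic X (path_join (loop \<gamma>) (loop \<delta>)) (loop (path_join \<gamma> \<delta>))"
    if \<gamma>: "pathin X \<gamma>" and \<delta>: "pathin X \<delta>" and ends: "\<gamma> 1 = \<delta> 0" for \<gamma> \<delta>
  proof -
    let ?a = "A (\<gamma> 0)" and ?b = "A (\<delta> 0)" and ?c = "path_reverse (A (\<delta> 1))"
    note [simp] = \<gamma> \<delta> ends
    have "path_homotopic X (path_join (path_join (path_join ?a \<gamma>) (path_reverse ?b)) (path_join (path_join ?b \<delta>) ?c))
        (path_join (path_join (path_join ?a \<gamma>) (path_reverse ?b)) (path_join ?b (path_join \<delta> ?c)))"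
      by (rule path_homotopic_join_right[OF _ path_homotopic_assoc]) simp_all
    also have "path_homotopic X \<dots> (path_join (path_join ?a \<gamma>) (path_join \<delta> ?c))"
      by (rule path_homotopic_cancel_reverse) simp_all
    also have "path_homotopic X \<dots> (path_join (path_join (path_join ?a \<gamma>) \<delta>) ?c)"
      by (rule path_homotopic_sym, rule path_homotopic_assoc) simp_all
    also have "path_homotopic X \<dots> (path_join (path_join ?a (path_join \<gamma> \<delta>)) ?c)"
      by (rule path_homotopic_join_left, rule path_homotopic_assoc) simp_all
    finally show ?thesis
      by (simp add: loop_def)
  qed
  have \<tau>_join: "\<tau> (path_join \<gamma> \<delta>) = \<tau> \<gamma> \<otimes>\<^bsub>G\<^esub> \<tau> \<delta>"
    if "pathin X \<gamma>" "pathin X \<delta>" "\<gamma> 1 = \<delta> 0" for \<gamma> \<delta>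
    using path_class_eq[OF loop_join[OF that]] loop that
    by (simp add: \<tau>_def G_def fundamental_group_simps path_class_mult)
  have \<tau>_homotopic: "\<tau> \<gamma> = \<tau> \<delta>" if hom: "path_homotopic X \<gamma> \<delta>" for \<gamma> \<delta>
  proof -
    note paths = path_homotopic_imp_pathin[OF hom] and ends = path_homotopic_endpoints[OF hom]
    have "path_homotopic X (loop \<gamma>) (loop \<delta>)"
      unfolding loop_def ends
      by (rule path_homotopic_join_left, rule path_homotopic_join_right[OF _ hom])
        (simp_all add: paths)
    then show ?thesis
      unfolding \<tau>_def by (rule path_class_eq)
  qed
  have \<tau>_const: "\<tau> (\<lambda>_. a) = \<one>\<^bsub>G\<^esub>" if a: "a \<in> topspace X" for a
  proof -
    have "path_homotopic X (loop (\<lambda>_. a)) (path_join (A a) (path_reverse (A a)))"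
      unfolding loop_def
      by (rule path_homotopic_join_left, rule path_homotopic_join_const) (simp_all add: a)
    also have "path_homotopic X \<dots> (\<lambda>_. x0)"
      by (rule path_homotopic_join_reverse) (simp_all add: a)
    finally show ?thesis
      unfolding \<tau>_def G_def fundamental_group_simps by (rule path_class_eq)
  qed
  have "T f = \<one>\<^bsub>G Mod H\<^esub>"
  proof (rule transport_of_null_homotopic[OF Q.is_group _ _ _ _ f null])
    show "T \<gamma> \<in> carrier (G Mod H)" if "pathin X \<gamma>" for \<gamma>
      unfolding T_def by (rule hom_in_carrier[OF r_coset_hom_Mod \<tau>_closed[OF that]])
    show "T (path_join \<gamma> \<delta>) = T \<gamma> \<otimes>\<^bsub>G Mod H\<^esub> T \<delta>"
      if "pathin X \<gamma>" "pathin X \<delta>" "\<gamma> 1 = \<delta> 0" for \<gamma> \<delta>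
      unfolding T_def \<tau>_join[OF that]
      by (rule hom_mult[OF r_coset_hom_Mod \<tau>_closed[OF that(1)] \<tau>_closed[OF that(2)]])
    show "T \<gamma> = T \<delta>" if "path_homotopic X \<gamma> \<delta>" for \<gamma> \<delta>
      unfolding T_def \<tau>_homotopic[OF that] ..
    \<comment> \<open>With tail \<open>A (\<gamma> 0)\<close>, the path \<open>\<gamma>\<close> in
      \<open>U\<close> and the reverse of \<open>\<delta>\<close> in \<open>V\<close> form a
      generator, which is the quotient of \<open>\<tau> \<gamma>\<close> by
      \<open>\<tau> \<delta>\<close>. This is the point where a generator has to involve two
      different members.\<close>
    show "T \<gamma> = T \<delta>"
      if UV: "U \<in> \<U>" "V \<in> \<U>" and paths: "pathin (subtopology X U) \<gamma>" "pathin (subtopology X V) \<delta>"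
        and ends: "\<gamma> 0 = \<delta> 0" "\<gamma> 1 = \<delta> 1" for U V \<gamma> \<delta>
    proof -
      let ?r = "path_reverse \<delta>"
      have \<gamma>: "pathin X \<gamma>" and \<delta>: "pathin X \<delta>"
        using paths by (simp_all only: pathin_subtopology)
      have r: "pathin (subtopology X V) ?r" "pathin X ?r"
        using pathin_reverse[OF paths(2)] pathin_reverse[OF \<delta>] .
      note [simp] = \<gamma> \<delta> ends
      note closed = \<tau>_closed[OF \<gamma>] \<tau>_closed[OF \<delta>] \<tau>_closed[OF r(2)]
      have "\<tau> \<delta> \<otimes>\<^bsub>G\<^esub> \<tau> ?r = \<tau> (path_join \<delta> ?r)"
        by (rule \<tau>_join[symmetric]) (simp_all add: r)
      also have "\<dots> = \<tau> (\<lambda>_. \<delta> 0)"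
        by (rule \<tau>_homotopic[OF path_homotopic_join_reverse]) simp_all
      finally have inv: "\<tau> \<delta> \<otimes>\<^bsub>G\<^esub> \<tau> ?r = \<one>\<^bsub>G\<^esub>"
        using \<tau>_const[of "\<delta> 0"] by simp
      have "\<tau> \<gamma> \<otimes>\<^bsub>G\<^esub> \<tau> ?r = \<tau> (path_join \<gamma> ?r)"
        by (rule \<tau>_join[symmetric]) (simp_all add: r)
      also have "\<dots> = path_class X
          (path_join (path_join (path_join (A (\<gamma> 0)) \<gamma>) ?r) (path_reverse (A (\<gamma> 0))))"
        unfolding \<tau>_def loop_def
        by (rule path_class_eq) (simp add: r path_homotopic_join_left path_homotopic_sym path_homotopic_assoc)
      also have "\<dots> \<in> thick_spanier_generators X \<U> x0"
        unfolding thick_spanier_generators_eq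
        by (intro CollectI exI[of _ "A (\<gamma> 0)"] exI[of _ \<gamma>] exI[of _ ?r] exI[of _ U] exI[of _ V])
          (simp add: UV paths r)
      finally have "\<tau> \<gamma> \<otimes>\<^bsub>G\<^esub> \<tau> ?r \<in> H"
        unfolding H_def carrier_thick_spanier_group by (rule generate.incl)
      then have "(\<tau> \<gamma> \<otimes>\<^bsub>G\<^esub> \<tau> ?r) \<otimes>\<^bsub>G\<^esub> \<tau> \<delta> \<in> H #>\<^bsub>G\<^esub> \<tau> \<delta>"
        by (auto simp: r_coset_def)
      moreover have "\<tau> ?r \<otimes>\<^bsub>G\<^esub> \<tau> \<delta> = \<one>\<^bsub>G\<^esub>"
        by (rule G.inv_comm[OF inv closed(2,3)])
      ultimately have "\<tau> \<gamma> \<in> H #>\<^bsub>G\<^esub> \<tau> \<delta>"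
        using closed by (simp add: G.m_assoc)
      then show ?thesis
        unfolding T_def by (rule G.repr_independence[OF _ closed(2) is_subgroup, symmetric])
    qed
  qed
  moreover have "\<tau> f = path_class X f"
  proof -
    have loop_f: "loop f = path_join (path_join (\<lambda>_. x0) f) (\<lambda>_. x0)"
      by (simp add: loop_def f A0 path_reverse_def)
    have "path_homotopic X (loop f) (path_join (\<lambda>_. x0) f)"
      unfolding loop_f by (rule path_homotopic_join_const) (simp_all add: f basepoint)
    also have "path_homotopic X \<dots> f"
      by (rule path_homotopic_const_join) (simp_all add: f)
    finally show ?thesis
      unfolding \<tau>_def by (rule path_class_eq)
  qed
  ultimately have "H #>\<^bsub>G\<^esub> path_class X f = H"
    unfolding T_def by (simp add: FactGroup_def)
  then show ?thesis
    using G.coset_join1[OF _ _ is_subgroup] f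
    by (simp add: G_def H_def path_class_in_carrier)
qed

text \<open>The path \<open>\<gamma>1\<close> and the reverse of \<open>\<gamma>2\<close> have the
  same endpoints and lie in members, so \<open>p_paths_homotopic\<close> identifies their images.
  The middle of the loop then cancels, and after it the tail against its reverse.\<close>

lemma thick_spanier_generator_in_kernel:
  assumes "c \<in> thick_spanier_generators X \<U> x0"
  shows "fundamental_group_induced realization p c = path_class realization (\<lambda>_. realization_vertex U0)"
proof -
  obtain \<alpha> \<gamma>1 \<gamma>2 U1 U2
    where c: "c = path_class X (path_join (path_join (path_join \<alpha> \<gamma>1) \<gamma>2) (path_reverse \<alpha>))"
      and \<alpha>: "pathin X \<alpha>" "\<alpha> 0 = x0" and U: "U1 \<in> \<U>" "U2 \<in> \<U>"
      and \<gamma>: "pathin (subtopology X U1) \<gamma>1" "pathin (subtopology X U2) \<gamma>2"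
      and ends: "\<gamma>1 0 = \<alpha> 1" "\<gamma>2 1 = \<alpha> 1" "\<gamma>1 1 = \<gamma>2 0"
    using assms unfolding thick_spanier_generators_eq by blast
  have \<gamma>X: "pathin X \<gamma>1" "pathin X \<gamma>2"
    using \<gamma> by (simp_all only: pathin_subtopology)
  define a g1 g2 where "a = p \<circ> \<alpha>" and "g1 = p \<circ> \<gamma>1" and "g2 = p \<circ> \<gamma>2"
  have paths: "pathin realization a" "pathin realization g1" "pathin realization g2"
    unfolding a_def g1_def g2_def by (intro pathin_compose[OF _ continuous_p] \<alpha> \<gamma>X)+
  have pends: "a 0 = realization_vertex U0" "g1 0 = a 1" "g2 1 = a 1" "g1 1 = g2 0"
    by (simp_all add: a_def g1_def g2_def \<alpha> ends p_basepoint)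
  note [simp] = pathin_join pathin_reverse paths pends
  have rev: "p \<circ> path_reverse \<delta> = path_reverse (p \<circ> \<delta>)" for \<delta>
    by (simp add: path_reverse_def o_def)
  have "path_homotopic realization g1 (p \<circ> path_reverse \<gamma>2)"
    unfolding g1_def
    by (rule p_paths_homotopic[OF U(1) \<gamma>(1) U(2) pathin_reverse[OF \<gamma>(2)]]) (simp_all add: ends)
  then have g: "path_homotopic realization g1 (path_reverse g2)"
    by (simp add: rev g2_def)
  have "path_homotopic realization (path_join (path_join (path_join a g1) g2) (path_reverse a))
      (path_join (path_join a (path_join g1 g2)) (path_reverse a))"
    by (rule path_homotopic_join_left, rule path_homotopic_assoc) simp_all
  also have "path_homotopic realization \<dots> (path_join (path_join a (path_join (path_reverse g2) g2)) (path_reverse a))"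
    by (rule path_homotopic_join_left, rule path_homotopic_join_right, simp,
        rule path_homotopic_join_left[OF g]) simp_all
  also have "path_homotopic realization \<dots> (path_join (path_join a (\<lambda>_. a 1)) (path_reverse a))"
    by (rule path_homotopic_join_left, rule path_homotopic_join_right, simp,
        rule path_homotopic_reverse_join) simp_all
  also have "path_homotopic realization \<dots> (path_join a (path_reverse a))"
    by (rule path_homotopic_join_left, rule path_homotopic_join_const) simp_all
  also have "path_homotopic realization \<dots> (\<lambda>_. realization_vertex U0)"
    by (rule path_homotopic_join_reverse) simp_all
  finally have null: "path_homotopic realization
      (path_join (path_join (path_join a g1) g2) (path_reverse a)) (\<lambda>_. realization_vertex U0)" .
  have "pathin X (path_join (path_join (path_join \<alpha> \<gamma>1) \<gamma>2) (path_reverse \<alpha>))"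
    by (simp add: \<alpha> \<gamma>X ends)
  from fundamental_group_induced_path_class[OF continuous_p this] show ?thesis
    unfolding c path_join_compose rev using path_class_eq[OF null]
    by (simp only: a_def g1_def g2_def)
qed

text \<open>Since the kernel is a subgroup, it contains the thick Spanier group as soon as it
  contains the generators. The reverse inclusion and surjectivity are proved on representing
  loops.\<close>

lemma short_exact_thick_spanier_group:
  "short_exact (thick_spanier_group X \<U> x0) (\<lambda>c. c) (fundamental_group X x0)
     (fundamental_group_induced realization p) (fundamental_group realization (realization_vertex U0))"
proof -
  let ?G = "fundamental_group X x0" and ?H = "fundamental_group realization (realization_vertex U0)"
  let ?p = "fundamental_group_induced realization p" and ?S = "thick_spanier_group X \<U> x0"
  interpret p: group_hom ?G ?H ?p
    using group_hom_fundamental_group_induced[OF continuous_p basepoint] by (simp add: p_basepoint)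
  have one: "\<one>\<^bsub>?H\<^esub> = path_class realization (\<lambda>_. realization_vertex U0)"
    by (simp add: fundamental_group_simps)
  have vertex: "realization_vertex U0 \<in> topspace realization"
    using p_in_realization[OF basepoint] by (simp add: p_basepoint)
  have hom: "group_hom ?S ?G (\<lambda>c. c)"
  proof -
    have "carrier ?S \<subseteq> carrier ?G"
      unfolding carrier_thick_spanier_group
      by (rule p.G.generate_incl[OF thick_spanier_generators_subset])
    moreover have "group ?S"
      unfolding thick_spanier_group_def by (rule p.G.group_subgroup_generated)
    ultimately show ?thesis
      using p.G.is_group
      by (auto simp: group_hom_def group_hom_axioms_def hom_def thick_spanier_group_def)
  qed
  have S_le: "carrier ?S \<subseteq> kernel ?G ?H ?p"
    unfolding carrier_thick_spanier_group
    using thick_spanier_generator_in_kernel thick_spanier_generators_subset[of X \<U> x0]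
    by (intro p.G.generate_subgroup_incl p.subgroup_kernel) (auto simp: kernel_def one)
  have S_ge: "kernel ?G ?H ?p \<subseteq> carrier ?S"
  proof
    fix c assume c: "c \<in> kernel ?G ?H ?p"
    then obtain f where f: "c = path_class X f" "pathin X f" "f 0 = x0" "f 1 = x0"
      by (auto simp: kernel_def fundamental_group_simps)
    have "path_class realization (p \<circ> f) = path_class realization (\<lambda>_. realization_vertex U0)"
      using c f fundamental_group_induced_path_class[OF continuous_p f(2)] by (simp add: kernel_def one)
    then have "path_homotopic realization (p \<circ> f) (\<lambda>_. realization_vertex U0)"
      by (rule path_class_eqD) (simp add: vertex)
    then show "c \<in> carrier ?S"
      unfolding f(1) by (rule kernel_subset_thick_spanier_group[OF f(2-)])
  qed
  have onto: "carrier ?H \<subseteq> ?p ` carrier ?G"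
  proof
    fix c assume "c \<in> carrier ?H"
    then obtain L where L: "c = path_class realization L" "pathin realization L"
      "L 0 = realization_vertex U0" "L 1 = realization_vertex U0"
      by (auto simp: fundamental_group_simps)
    from realization_loop_lifts[OF L(2-)] obtain \<delta> where \<delta>: "pathin X \<delta>" "\<delta> 0 = x0" "\<delta> 1 = x0"
      "path_homotopic realization (p \<circ> \<delta>) L"
      by blast
    have "c = ?p (path_class X \<delta>)"
      unfolding L(1) fundamental_group_induced_path_class[OF continuous_p \<delta>(1)]
      by (rule path_class_eq[OF \<delta>(4), symmetric])
    then show "c \<in> ?p ` carrier ?G"
      using path_class_in_carrier[OF \<delta>(1-3)] by blast
  qed
  have "?p ` carrier ?G = carrier ?H"
    using p.hom_closed onto by blast
  then show ?thesis
    unfolding short_exact_def image_ident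
    by (intro conjI hom p.group_hom_axioms inj_on_id2 subset_antisym[OF S_le S_ge])
qed

end

theorem theorem19:
  fixes X :: "'a topology" and x0 :: 'a and \<U> :: "'a set set" and U0 :: "'a set"
    and p :: "'a \<Rightarrow> 'a set \<Rightarrow> real"
  assumes "path_connected_space X" and "x0 \<in> topspace X"
    and "(\<U>, U0) \<in> covers_Lambda X x0"
    and "\<forall>U\<in>\<U>. path_connectedin X U"
    and "canonical_map X x0 \<U> U0 p"
  shows "short_exact
           (thick_spanier_group X \<U> x0) (\<lambda>c. c)
           (fundamental_group X x0)
           (fundamental_group_induced (geometric_realization (nerve \<U>)) p)
           (fundamental_group (geometric_realization (nerve \<U>)) (realization_vertex U0))"
proof -
  interpret canonical_cover X x0 \<U> U0 p
    using assms by unfold_locales (auto simp: covers_Lambda_def)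
  show ?thesis
    by (rule short_exact_thick_spanier_group)
qed

end
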